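(* Let $\mu$ be an $\alpha$-regular, symmetric and isotropic probability measure on $\mathbb{R}^n$ with $\alpha\ge1$. Let $\beta,\gamma>0$. Then: (i) If $\mu$ satisfies $\mathrm{IC}(\beta)$, then $\mu$ satisfies $\mathrm{CI}(8e\alpha\beta)$. (ii) If $\mu$ satisfies $\mathrm{CI}(\beta)$ and additionally satisfies Cheeger's inequality with constant $1/\gamma$, then $\mu$ satisfies $\mathrm{IC}(36\max\{6e\beta,\gamma\})$.
   Context: A probability measure $\mu$ on $\mathbb{R}^n$ is symmetric if $\mu(-A)=\mu(A)$ for Borel $A$; isotropic if $\int\langle u,x\rangle d\mu(x)=0$ and $\int\langle u,x\rangle^2d\mu(x)=|u|^2$ for all $u\in\mathbb{R}^n$ ($|\cdot|$ the Euclidean norm); $\alpha$-regular if for all $p\ge q\ge2$ and $v\in\mathbb{R}^n$, $(\int|\langle v,x\rangle|^pd\mu)^{1/p}\le\alpha\frac pq(\int|\langle v,x\rangle|^qd\mu)^{1/q}$. Property $(\tau)$ and $\mathrm{IC}$: for functions $f,g$, $f\Box g(x):=\inf_{y\in\mathbb{R}^n}\{f(x-y)+g(y)\}$. For measurable $\varphi:\mathbb{R}^n\to[0,\infty]$, $(\mu,\varphi)$ has property $(\tau)$ if $\int e^{f\Box\varphi}d\mu\int e^{-f}d\mu\le1$ for every bounded measurable $f:\mathbb{R}^n\to\mathbb{R}$. With $\Lambda_\mu(v)=\log\int e^{\langle v,x\rangle}d\mu(x)$ and $\Lambda^\star_\mu(v)=\sup_u\{\langle v,u\rangle-\Lambda_\mu(u)\}$,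 a symmetric probability measure $\mu$ satisfies $\mathrm{IC}(\beta)$ if $(\mu,\Lambda^\star_\mu(\cdot/\beta))$ has property $(\tau)$. $\mathrm{CI}$: for $p\ge1$ let $\mathcal{Z}_p(\mu)=\{x\in\mathbb{R}^n: |\langle v,x\rangle|^p\le\int|\langle v,y\rangle|^pd\mu(y)\text{ for all }v\in\mathbb{R}^n\}$. $\mu$ satisfies $\mathrm{CI}(\beta)$ if for all $p\ge2$ and all Borel $A$ with $\mu(A)\ge\frac12$ one has $1-\mu(A+\beta\mathcal{Z}_p(\mu))\le e^{-p}(1-\mu(A))$. Cheeger's inequality with constant $\kappa$: for every Borel set $A$, $\mu^+(A):=\liminf_{t\to0+}\frac{\mu(A+tB_2^n)-\mu(A)}{t}\ge\kappa\min\{\mu(A),1-\mu(A)\}$, where $B_2^n$ is the Euclidean unit ball. *)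

theory Defs
  imports "HOL-Probability.Probability_Measure"
begin

(* All measures below are Borel probability measures: prob_space M and sets M = sets borel
   are assumed explicitly wherever they are needed. *)

definition symmetric_measure :: "'a::euclidean_space measure \<Rightarrow> bool" where
  "symmetric_measure M \<longleftrightarrow> (\<forall>A\<in>sets borel. measure M (uminus ` A) = measure M A)"

definition isotropic :: "'a::euclidean_space measure \<Rightarrow> bool" where
  "isotropic M \<longleftrightarrow> (\<forall>u.
     integrable M (\<lambda>x. u \<bullet> x) \<and> (\<integral>x. u \<bullet> x \<partial>M) = 0 \<and>
     integrable M (\<lambda>x. (u \<bullet> x)\<^sup>2) \<and> (\<integral>x. (u \<bullet> x)\<^sup>2 \<partial>M) = (norm u)\<^sup>2)"

(* Moments take values in [0,\<infinity>], so that divergent ones are not silently read as 0. *)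
definition abs_moment :: "'a::euclidean_space measure \<Rightarrow> real \<Rightarrow> 'a \<Rightarrow> ennreal" where
  "abs_moment M p v = (\<integral>\<^sup>+ x. ennreal (\<bar>v \<bullet> x\<bar> powr p) \<partial>M)"

(* Only used for r > 0. *)
definition ennreal_powr :: "ennreal \<Rightarrow> real \<Rightarrow> ennreal" where
  "ennreal_powr a r = (if a = top then top else ennreal (enn2real a powr r))"

definition regular_measure :: "real \<Rightarrow> 'a::euclidean_space measure \<Rightarrow> bool" where
  "regular_measure \<alpha> M \<longleftrightarrow> (\<forall>p q v. 2 \<le> q \<and> q \<le> p \<longrightarrow>
     ennreal_powr (abs_moment M p v) (1 / p)
       \<le> ennreal (\<alpha> * (p / q)) * ennreal_powr (abs_moment M q v) (1 / q))"

definition exp_ereal :: "ereal \<Rightarrow> ennreal" where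
  "exp_ereal x = (case x of ereal r \<Rightarrow> ennreal (exp r) | PInfty \<Rightarrow> top | MInfty \<Rightarrow> 0)"

definition ln_ennreal :: "ennreal \<Rightarrow> ereal" where
  "ln_ennreal a = (if a = top then \<infinity> else if a = 0 then -\<infinity> else ereal (ln (enn2real a)))"

definition inf_conv :: "('a::euclidean_space \<Rightarrow> ereal) \<Rightarrow> ('a \<Rightarrow> ereal) \<Rightarrow> 'a \<Rightarrow> ereal" where
  "inf_conv f g x = (INF y. f (x - y) + g y)"

(* The infimal convolution of Borel functions need not be Borel, but its sublevel sets are
   analytic, hence it is measurable for the completion of M.  The nonnegative integral over M
   agrees with that over completion M for every integrand (nn_integral_completion), so the
   first factor is the usual integral with respect to the completed measure. *)
definition property_tau :: "'a::euclidean_space measure \<Rightarrow> ('a \<Rightarrow> ereal) \<Rightarrow> bool" where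
  "property_tau M \<phi> \<longleftrightarrow>
     \<phi> \<in> borel_measurable borel \<and> (\<forall>x. 0 \<le> \<phi> x) \<and>
     (\<forall>f::'a \<Rightarrow> real. f \<in> borel_measurable borel \<and> bounded (range f) \<longrightarrow>
        (\<integral>\<^sup>+ x. exp_ereal (inf_conv (\<lambda>y. ereal (f y)) \<phi> x) \<partial>M)
          * (\<integral>\<^sup>+ x. ennreal (exp (- f x)) \<partial>M) \<le> 1)"

definition log_laplace :: "'a::euclidean_space measure \<Rightarrow> 'a \<Rightarrow> ereal" where
  "log_laplace M v = ln_ennreal (\<integral>\<^sup>+ x. ennreal (exp (v \<bullet> x)) \<partial>M)"

definition cramer_transform :: "'a::euclidean_space measure \<Rightarrow> 'a \<Rightarrow> ereal" where
  "cramer_transform M v = (SUP u. ereal (v \<bullet> u) - log_laplace M u)"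

definition IC :: "real \<Rightarrow> 'a::euclidean_space measure \<Rightarrow> bool" where
  "IC \<beta> M \<longleftrightarrow> property_tau M (\<lambda>x. cramer_transform M (x /\<^sub>R \<beta>))"

(* For Borel A and compact K the Minkowski sum A + K is analytic but possibly not Borel, in
   which case "measure M" would return 0.  Analytic sets are universally measurable, and on
   sets measurable for the completion of M the outer measure is the completed measure. *)
definition completed_measure :: "'a measure \<Rightarrow> 'a set \<Rightarrow> real" where
  "completed_measure M A = enn2real (outer_measure_of M A)"

lemma completed_measure_eq:
  assumes "A \<in> sets (completion M)"
  shows "completed_measure M A = measure (completion M) A"
proof -
  obtain A' where A': "A' \<in> sets M" "A \<subseteq> A'" "emeasure (completion M) A = emeasure M A'"
    using completion_upper[OF assms] by blast
  have "outer_measure_of M A = emeasure (completion M) A"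
    unfolding outer_measure_of_def
  proof (rule antisym)
    show "(INF B\<in>{B \<in> sets M. A \<subseteq> B}. emeasure M B) \<le> emeasure (completion M) A"
      using A' by (intro INF_lower2[of A']) simp_all
    show "emeasure (completion M) A \<le> (INF B\<in>{B \<in> sets M. A \<subseteq> B}. emeasure M B)"
    proof (rule INF_greatest)
      fix B assume B: "B \<in> {B \<in> sets M. A \<subseteq> B}"
      then have "emeasure (completion M) A \<le> emeasure (completion M) B"
        by (intro emeasure_mono) auto
      also have "\<dots> = emeasure M B"
        using B by simp
      finally show "emeasure (completion M) A \<le> emeasure M B" .
    qed
  qed
  then show ?thesis
    by (simp add: completed_measure_def measure_def)
qed

definition Zp_body :: "real \<Rightarrow> 'a::euclidean_space measure \<Rightarrow> 'a set" where
  "Zp_body p M = {x. \<forall>v. ennreal (\<bar>v \<bullet> x\<bar> powr p) \<le> abs_moment M p v}"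

definition CI :: "real \<Rightarrow> 'a::euclidean_space measure \<Rightarrow> bool" where
  "CI \<beta> M \<longleftrightarrow> (\<forall>p\<ge>2. \<forall>A\<in>sets borel. measure M A \<ge> 1 / 2 \<longrightarrow>
     1 - completed_measure M {a + \<beta> *\<^sub>R z |a z. a \<in> A \<and> z \<in> Zp_body p M}
       \<le> exp (- p) * (1 - measure M A))"

definition boundary_measure :: "'a::euclidean_space measure \<Rightarrow> 'a set \<Rightarrow> ereal" where
  "boundary_measure M A =
     Liminf (at_right 0) (\<lambda>t::real. ereal
       ((completed_measure M {a + t *\<^sub>R b |a b. a \<in> A \<and> b \<in> cball 0 1} - measure M A) / t))"

definition cheeger :: "real \<Rightarrow> 'a::euclidean_space measure \<Rightarrow> bool" where
  "cheeger \<kappa> M \<longleftrightarrow> (\<forall>A\<in>sets borel.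
     boundary_measure M A \<ge> ereal (\<kappa> * min (measure M A) (1 - measure M A)))"

end

theory Submission
  imports Defs
begin

text \<open>
Both parts translate a functional inequality into enlargement inequalities of the form
\<open>1 - \<mu> (A + K) \<le> exp (- t) * (1 - \<mu> A)\<close> for \<open>\<mu> A \<ge> 1/2\<close>, or back. Write \<open>\<Lambda>*\<close> for
the Cramer transform and \<open>Z p\<close> for \<open>Zp_body p \<mu>\<close>.

From \<open>IC\<close> to \<open>CI\<close>: testing property \<open>(\<tau>)\<close> with the function that is \<open>0\<close> on \<open>A\<close> and \<open>2 * p\<close> off
\<open>A\<close> shows that \<open>K = {\<phi> \<le> 2 * p}\<close> has this property with \<open>t = p\<close> (\<open>property_tau_enlarges\<close>).
Since \<open>\<Lambda>*\<close> is convex and vanishes at \<open>0\<close>, \<open>{\<Lambda>* \<le> 2 * p} \<subseteq> 2 * {\<Lambda>* \<le> p}\<close>, and regularity bounds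
the exponential moments of linear functionals by a power series, which gives
\<open>{\<Lambda>* \<le> p} \<subseteq> (4 * e * \<alpha>) * Z p\<close> (\<open>cramer_sublevel_subset_Zp_body\<close>).

From \<open>CI\<close> and Cheeger to \<open>IC\<close>: Cheeger's inequality, integrated, enlarges by Euclidean balls of
radius comparable to \<open>\<gamma> * t\<close>, which serve for \<open>t < 2\<close>; for \<open>t \<ge> 2\<close> the sets \<open>\<beta> * Z t\<close> from \<open>CI\<close>
are used. On these sets the rescaled \<open>\<Lambda>*\<close> is below the one-dimensional cost \<open>ln (cosh (t / 3))\<close>:
near the origin \<open>\<Lambda>*\<close> is at most quadratic, and \<open>\<Lambda>* \<le> t\<close> on \<open>Z t\<close>. It remains to recover property
\<open>(\<tau>)\<close> from enlargement inequalities (\<open>property_tau_of_enlargements\<close>). Because they hold at every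
level, they compare the distribution functions of \<open>f\<close> and of \<open>q = f \<box> \<phi>\<close>. After adding a constant to
\<open>f\<close>, chosen so that level \<open>0\<close> is the point where enlarged sublevel sets reach measure \<open>1/2\<close>, the
comparison gives \<open>E (exp q - 1)\<^sup>+ \<le> E (1 - exp (- f))\<^sup>+\<close> from the levels above and
\<open>E (exp (- f) - 1)\<^sup>+ \<le> E (1 - exp q)\<^sup>+\<close> from the levels below. Adding these yields
\<open>E (exp q) + E (exp (- f)) \<le> 2\<close>, and the inequality between the arithmetic and the geometric mean
bounds the product by \<open>1\<close>.
\<close>

section \<open>Comparison of distribution functions\<close>

text \<open>
The weight \<open>r\<^bsup>-3\<^esup>\<close> is minus the derivative of \<open>(1 + r\<^bsup>-2\<^esup>) / 2\<close>, so the integral is the length of the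
part of \<open>(1/2, 1)\<close> that lies above \<open>a\<close>.
\<close>
lemma nn_integral_cube_tail_le:
  fixes a :: real
  shows "(\<integral>\<^sup>+r. indicator {r. 1 < r \<and> a \<le> (1 + 1 / r^2) / 2} r * ennreal (1 / r^3) \<partial>lborel)
           \<le> ennreal (1 - a)"
proof -
  let ?F = "\<lambda>r::real. - (1 / (2 * r^2))"
  have der: "DERIV ?F r :> 1 / r^3" if "1 \<le> r" for r
    using that by (auto intro!: derivative_eq_intros simp: power2_eq_square power3_eq_cube field_simps)
  consider "1 \<le> a" | "1/2 < a" "a < 1" | "a \<le> 1/2" by linarith
  then show ?thesis
  proof cases
    case 1
    have "{r. 1 < r \<and> a \<le> (1 + 1 / r^2) / 2} = {}"
    proof (intro equals0I, clarify)
      fix r :: real assume r: "1 < r" "a \<le> (1 + 1 / r\<^sup>2) / 2"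
      then have "1 / r^2 < 1" by (simp add: power_strict_mono one_less_power)
      with r 1 show False by argo
    qed
    then show ?thesis by (simp only:) simp
  next
    case 2
    define R where "R = 1 / sqrt (2 * a - 1)"
    have "0 < 2 * a - 1" "2 * a - 1 < 1" using 2 by auto
    then have R: "1 \<le> R" "1 / R^2 = 2 * a - 1"
      by (auto simp: R_def field_simps)
    have sub: "{r. 1 < r \<and> a \<le> (1 + 1 / r^2) / 2} \<subseteq> {1..R}"
    proof clarify
      fix r :: real assume r: "1 < r" "a \<le> (1 + 1 / r\<^sup>2) / 2"
      then have "1 / R^2 \<le> 1 / r^2" using R by simp
      moreover have "0 < r^2" "0 < R^2" using r R by auto
      ultimately have "r^2 \<le> R^2" by (simp add: field_simps del: zero_less_power2)
      then have "r \<le> R" using R by (auto dest: power2_le_imp_le)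
      then show "r \<in> {1..R}" using r by simp
    qed
    have "(\<integral>\<^sup>+r. indicator {r. 1 < r \<and> a \<le> (1 + 1 / r^2) / 2} r * ennreal (1 / r^3) \<partial>lborel)
        \<le> (\<integral>\<^sup>+r. ennreal (1 / r^3) * indicator {1..R} r \<partial>lborel)"
      using sub by (intro nn_integral_mono) (auto split: split_indicator)
    also have "\<dots> = ennreal (?F R - ?F 1)"
      by (rule nn_integral_FTC_Icc) (use R der in auto)
    also have "?F R - ?F 1 = 1 - a"
    proof -
      have "?F R = - ((1 / R^2) / 2)" by simp
      then show ?thesis unfolding R by (simp add: field_simps)
    qed
    finally show ?thesis .
  next
    case 3
    have "(\<integral>\<^sup>+r. indicator {r. 1 < r \<and> a \<le> (1 + 1 / r^2) / 2} r * ennreal (1 / r^3) \<partial>lborel)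
        \<le> (\<integral>\<^sup>+r. ennreal (1 / r^3) * indicator {1..} r \<partial>lborel)"
      by (intro nn_integral_mono) (auto split: split_indicator)
    also have "\<dots> = ennreal (0 - ?F 1)"
    proof (rule nn_integral_FTC_atLeast[where F = ?F])
      have "((\<lambda>r::real. - (inverse r ^ 2 / 2)) \<longlongrightarrow> - (0 ^ 2 / 2)) at_top"
        by (intro tendsto_intros tendsto_inverse_0_at_top filterlim_ident) auto
      moreover have "(\<lambda>r::real. - (inverse r ^ 2 / 2)) = ?F"
        by (simp add: fun_eq_iff inverse_eq_divide power_divide)
      ultimately show "(?F \<longlongrightarrow> 0) at_top" by simp
    qed (use der in auto)
    also have "\<dots> \<le> ennreal (1 - a)" using 3 by (intro ennreal_leI) simp
    finally show ?thesis .
  qed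
qed

text \<open>
Both sides are integrals of tails: the left one is the integral of \<open>prob {r < b}\<close> over \<open>r > 1\<close>,
the right one dominates the integral of \<open>prob {a \<le> s}\<close> over \<open>1/2 < s < 1\<close>. The substitution
\<open>s = (1 + 1 / r\<^sup>2) / 2\<close> carries one to the other, and its Jacobian \<open>1 / r ^ 3\<close> cancels the factor in
the hypothesis.
\<close>
lemma (in prob_space) positive_part_le_of_tail_domination:
  fixes a b :: "'a \<Rightarrow> real"
  assumes [measurable]: "a \<in> borel_measurable M" "b \<in> borel_measurable M"
  assumes tail: "\<And>r. 1 < r \<Longrightarrow>
    r^3 * prob {x\<in>space M. r < b x} \<le> prob {x\<in>space M. a x \<le> (1 + 1 / r^2) / 2}"
  shows "(\<integral>\<^sup>+x. ennreal (b x - 1) \<partial>M) \<le> (\<integral>\<^sup>+x. ennreal (1 - a x) \<partial>M)"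
proof -
  interpret L: pair_sigma_finite M "lborel :: real measure" ..
  have "(\<integral>\<^sup>+x. ennreal (b x - 1) \<partial>M) = (\<integral>\<^sup>+x. \<integral>\<^sup>+r. indicator {r. 1 < r \<and> r < b x} r \<partial>lborel \<partial>M)"
  proof (intro nn_integral_cong)
    fix x
    have "{r. 1 < r \<and> r < b x} = {1<..<b x}" by auto
    then show "ennreal (b x - 1) = (\<integral>\<^sup>+r. indicator {r. 1 < r \<and> r < b x} r \<partial>lborel)"
      by (cases "1 \<le> b x") (simp_all add: ennreal_neg)
  qed
  also have "\<dots> = (\<integral>\<^sup>+r. \<integral>\<^sup>+x. indicator {r. 1 < r \<and> r < b x} r \<partial>M \<partial>lborel)"
    by (rule L.Fubini'[symmetric]) (simp add: indicator_def)
  also have "\<dots> \<le> (\<integral>\<^sup>+r. \<integral>\<^sup>+x. indicator {r. 1 < r \<and> a x \<le> (1 + 1 / r^2) / 2} r * ennreal (1 / r^3) \<partial>M \<partial>lborel)"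
  proof (rule nn_integral_mono)
    fix r :: real
    show "(\<integral>\<^sup>+x. indicator {r. 1 < r \<and> r < b x} r \<partial>M)
        \<le> (\<integral>\<^sup>+x. indicator {r. 1 < r \<and> a x \<le> (1 + 1 / r^2) / 2} r * ennreal (1 / r^3) \<partial>M)"
    proof (cases "1 < r")
      case True
      have "(\<integral>\<^sup>+x. indicator {r. 1 < r \<and> r < b x} r \<partial>M)
          = (\<integral>\<^sup>+x. indicator {x\<in>space M. r < b x} x \<partial>M)"
        using True by (intro nn_integral_cong) (auto split: split_indicator)
      also have "\<dots> = ennreal (prob {x\<in>space M. r < b x})"
        by (simp add: emeasure_eq_measure)
      also have "\<dots> \<le> ennreal (1 / r^3 * prob {x\<in>space M. a x \<le> (1 + 1 / r^2) / 2})"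
        using tail[OF True] True by (intro ennreal_leI) (simp add: field_simps)
      also have "\<dots> = (\<integral>\<^sup>+x. ennreal (1 / r^3) * indicator {x\<in>space M. a x \<le> (1 + 1 / r^2) / 2} x \<partial>M)"
        using True by (subst nn_integral_cmult_indicator) (simp_all add: emeasure_eq_measure flip: ennreal_mult')
      also have "\<dots> = (\<integral>\<^sup>+x. indicator {r. 1 < r \<and> a x \<le> (1 + 1 / r^2) / 2} r * ennreal (1 / r^3) \<partial>M)"
        using True by (intro nn_integral_cong) (auto split: split_indicator)
      finally show ?thesis .
    qed simp
  qed
  also have "\<dots> = (\<integral>\<^sup>+x. \<integral>\<^sup>+r. indicator {r. 1 < r \<and> a x \<le> (1 + 1 / r^2) / 2} r * ennreal (1 / r^3) \<partial>lborel \<partial>M)"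
    by (rule L.Fubini') (simp add: indicator_def)
  also have "\<dots> \<le> (\<integral>\<^sup>+x. ennreal (1 - a x) \<partial>M)"
    by (intro nn_integral_mono nn_integral_cube_tail_le)
  finally show ?thesis .
qed

text \<open>
The cost is dictated by the substitution above: an enlargement of size \<open>t = 3 * ln r\<close> gains the
factor \<open>r ^ 3\<close>, and passing from level \<open>ln r\<close> to level \<open>- ln ((1 + 1 / r\<^sup>2) / 2)\<close> costs their
difference, which is \<open>ln (cosh (ln r))\<close>.
\<close>
definition logcosh_cost :: "real \<Rightarrow> real" where
  "logcosh_cost t = ln (cosh (t / 3))"

lemma logcosh_cost_nonneg: "0 \<le> logcosh_cost t"
  by (simp add: logcosh_cost_def cosh_real_ge_1)

lemma logcosh_cost_ln:
  assumes "1 < (r::real)"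
  shows "logcosh_cost (3 * ln r) = ln r + ln ((1 + 1 / r^2) / 2)"
proof -
  have "logcosh_cost (3 * ln r) = ln (cosh (ln r))"
    by (simp add: logcosh_cost_def)
  also have "cosh (ln r) = r * ((1 + 1 / r^2) / 2)"
    using assms by (simp add: cosh_ln_real power2_eq_square field_simps)
  also have "ln \<dots> = ln r + ln ((1 + 1 / r^2) / 2)"
    using assms by (intro ln_mult_pos) (auto simp: add_pos_nonneg)
  finally show ?thesis .
qed

text \<open>
The identity \<open>E g = 1 + E (g - 1)\<^sup>+ - E (1 - g)\<^sup>+\<close> for \<open>g = a\<close> and \<open>g = b\<close> turns the two tail
dominations into a bound for the sum.
\<close>
lemma (in prob_space) expectation_le_2_of_tails:
  fixes a b :: "'a \<Rightarrow> real"
  assumes [measurable]: "a \<in> borel_measurable M" "b \<in> borel_measurable M"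
  assumes a: "\<And>x. x \<in> space M \<Longrightarrow> 0 \<le> a x \<and> a x \<le> C" and b: "\<And>x. x \<in> space M \<Longrightarrow> 0 \<le> b x \<and> b x \<le> C"
  assumes ab: "\<And>r. 1 < r \<Longrightarrow>
    r^3 * prob {x\<in>space M. r < b x} \<le> prob {x\<in>space M. a x \<le> (1 + 1 / r^2) / 2}"
  assumes ba: "\<And>r. 1 < r \<Longrightarrow>
    r^3 * prob {x\<in>space M. r < a x} \<le> prob {x\<in>space M. b x \<le> (1 + 1 / r^2) / 2}"
  shows "expectation a + expectation b \<le> 2"
proof -
  have int: "integrable M (\<lambda>x. max 0 (g x - 1))" "integrable M (\<lambda>x. max 0 (1 - g x))" "integrable M g"
    if [measurable]: "g \<in> borel_measurable M" and "\<And>x. x \<in> space M \<Longrightarrow> 0 \<le> g x \<and> g x \<le> C" for g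
  proof -
    have C: "\<bar>max 0 (g x - 1)\<bar> \<le> 1 + \<bar>C\<bar>" "\<bar>max 0 (1 - g x)\<bar> \<le> 1 + \<bar>C\<bar>" "\<bar>g x\<bar> \<le> 1 + \<bar>C\<bar>"
      if "x \<in> space M" for x
      using \<open>\<And>x. x \<in> space M \<Longrightarrow> 0 \<le> g x \<and> g x \<le> C\<close>[OF that] by linarith+
    show "integrable M (\<lambda>x. max 0 (g x - 1))" "integrable M (\<lambda>x. max 0 (1 - g x))" "integrable M g"
      by (rule integrable_const_bound[where B = "1 + \<bar>C\<bar>"], use C in \<open>simp add: AE_I2\<close>, measurable)+
  qed
  have nn: "(\<integral>x. max 0 (g x - 1) \<partial>M) \<le> (\<integral>x. max 0 (1 - h x) \<partial>M)"
    if le: "(\<integral>\<^sup>+x. ennreal (g x - 1) \<partial>M) \<le> (\<integral>\<^sup>+x. ennreal (1 - h x) \<partial>M)"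
      and "integrable M (\<lambda>x. max 0 (g x - 1))" "integrable M (\<lambda>x. max 0 (1 - h x))" for g h
  proof -
    have *: "ennreal (max 0 z) = ennreal z" for z by (simp add: max_def ennreal_neg)
    have "ennreal (\<integral>x. max 0 (g x - 1) \<partial>M) = (\<integral>\<^sup>+x. ennreal (g x - 1) \<partial>M)"
      using that(2,3) by (subst nn_integral_eq_integral[symmetric]) (auto simp: *)
    moreover have "ennreal (\<integral>x. max 0 (1 - h x) \<partial>M) = (\<integral>\<^sup>+x. ennreal (1 - h x) \<partial>M)"
      using that(2,3) by (subst nn_integral_eq_integral[symmetric]) (auto simp: *)
    ultimately have "ennreal (\<integral>x. max 0 (g x - 1) \<partial>M) \<le> ennreal (\<integral>x. max 0 (1 - h x) \<partial>M)"
      using le by simp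
    then show ?thesis by (subst (asm) ennreal_le_iff) (auto intro!: integral_nonneg_AE)
  qed
  have split: "(\<integral>x. g x \<partial>M) = 1 + (\<integral>x. max 0 (g x - 1) \<partial>M) - (\<integral>x. max 0 (1 - g x) \<partial>M)"
    if [measurable]: "g \<in> borel_measurable M" and "\<And>x. x \<in> space M \<Longrightarrow> 0 \<le> g x \<and> g x \<le> C" for g
  proof -
    have "(\<integral>x. g x \<partial>M) = (\<integral>x. (1 + max 0 (g x - 1)) - max 0 (1 - g x) \<partial>M)"
      by (intro Bochner_Integration.integral_cong) (auto simp: max_def)
    also have "\<dots> = (\<integral>x. 1 + max 0 (g x - 1) \<partial>M) - (\<integral>x. max 0 (1 - g x) \<partial>M)"
      using int(1,2)[OF that] by (intro Bochner_Integration.integral_diff Bochner_Integration.integrable_add) auto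
    also have "(\<integral>x. 1 + max 0 (g x - 1) \<partial>M) = 1 + (\<integral>x. max 0 (g x - 1) \<partial>M)"
      using int(1)[OF that] by (subst Bochner_Integration.integral_add) (auto simp: prob_space)
    finally show ?thesis .
  qed
  have "(\<integral>x. max 0 (b x - 1) \<partial>M) \<le> (\<integral>x. max 0 (1 - a x) \<partial>M)"
    by (rule nn[OF positive_part_le_of_tail_domination[OF assms(1,2) ab] int(1)[OF assms(2) b] int(2)[OF assms(1) a]])
  moreover have "(\<integral>x. max 0 (a x - 1) \<partial>M) \<le> (\<integral>x. max 0 (1 - b x) \<partial>M)"
    by (rule nn[OF positive_part_le_of_tail_domination[OF assms(2,1) ba] int(1)[OF assms(1) a] int(2)[OF assms(2) b]])
  ultimately show ?thesis
    using split[OF assms(1) a] split[OF assms(2) b] by linarith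
qed

text \<open>
This is the one-dimensional core of the passage to property \<open>(\<tau>)\<close>; \<open>q\<close> plays the role of the
infimum convolution. The number \<open>c\<close> is the level at which enlarged sublevel sets of \<open>f\<close> reach
measure \<open>1/2\<close>. Above \<open>c\<close> the complements shrink exponentially: directly if the sublevel set of \<open>f\<close>
already has measure \<open>1/2\<close>, and otherwise through two successive enlargements, the first of which
reaches \<open>1/2\<close>. Below \<open>c\<close> measure \<open>1/2\<close> is not reached, so the minimum in the hypothesis \<open>below\<close> is the
exponentially growing term.
\<close>
lemma (in prob_space) exp_product_le_1_of_levels:
  fixes f q :: "'a \<Rightarrow> real"
  assumes [measurable]: "f \<in> borel_measurable M" "q \<in> borel_measurable M"
  assumes f: "\<And>x. x \<in> space M \<Longrightarrow> \<bar>f x\<bar> \<le> B" and q: "\<And>x. x \<in> space M \<Longrightarrow> \<bar>q x\<bar> \<le> B"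
  assumes above: "\<And>s t. 0 < t \<Longrightarrow> 1 / 2 \<le> prob {x\<in>space M. f x \<le> s} \<Longrightarrow>
      prob {x\<in>space M. s + logcosh_cost t < q x} \<le> exp (- t) * prob {x\<in>space M. s < f x}"
  assumes below: "\<And>s t. 0 < t \<Longrightarrow>
      min (1 / 2) (exp t * prob {x\<in>space M. f x \<le> s}) \<le> prob {x\<in>space M. q x \<le> s + logcosh_cost t}"
  assumes across: "\<And>s t t'. 0 < t \<Longrightarrow> 0 < t' \<Longrightarrow> 1 / 2 < exp t * prob {x\<in>space M. f x \<le> s} \<Longrightarrow>
      prob {x\<in>space M. s + logcosh_cost t + logcosh_cost t' < q x} \<le> exp (- t') / 2"
  shows "(\<integral>\<^sup>+x. ennreal (exp (q x)) \<partial>M) * (\<integral>\<^sup>+x. ennreal (exp (- f x)) \<partial>M) \<le> 1"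
proof -
  define S where "S = {s. \<exists>t>0. 1 / 2 < exp t * prob {x\<in>space M. f x \<le> s - logcosh_cost t}}"
  define c where "c = Inf S"
  have S_mono: "s' \<in> S" if s: "s \<in> S" "s \<le> s'" for s s'
  proof -
    obtain t where t: "0 < t" "1 / 2 < exp t * prob {x\<in>space M. f x \<le> s - logcosh_cost t}"
      using s unfolding S_def by auto
    have "exp t * prob {x\<in>space M. f x \<le> s - logcosh_cost t} \<le> exp t * prob {x\<in>space M. f x \<le> s' - logcosh_cost t}"
      using s by (intro mult_left_mono finite_measure_mono) auto
    with t have "1 / 2 < exp t * prob {x\<in>space M. f x \<le> s' - logcosh_cost t}"
      by linarith
    with t show ?thesis unfolding S_def by blast
  qed
  have S_ge: "- B \<le> s" if "s \<in> S" for s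
  proof (rule ccontr)
    assume "\<not> - B \<le> s"
    then have "{x\<in>space M. f x \<le> s - logcosh_cost t} = {}" for t
      using f logcosh_cost_nonneg[of t] by fastforce
    with that show False unfolding S_def by simp
  qed
  have "{x\<in>space M. f x \<le> B + logcosh_cost 1 - logcosh_cost 1} = space M"
    using f by fastforce
  then have "B + logcosh_cost 1 \<in> S"
    unfolding S_def by (auto intro!: exI[of _ 1] simp: prob_space simp flip: add.assoc)
      (use exp_gt_one[of "1::real"] in linarith)
  then have S_ne: "S \<noteq> {}" by auto
  have S_bdd: "bdd_below S" using S_ge by (auto simp: bdd_below_def)
  have gt: "s \<in> S" if "c < s" for s
    using that S_mono S_ne S_bdd unfolding c_def by (auto simp: cInf_less_iff intro: less_imp_le)
  have lt: "s \<notin> S" if "s < c" for s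
    using that S_bdd cInf_lower[of s S] unfolding c_def by auto
  \<comment> \<open>The shift by \<open>c\<close> cancels in the product of the two expectations.\<close>
  define a where "a = (\<lambda>x. exp (c - f x))"
  define b where "b = (\<lambda>x. exp (q x - c))"
  have [measurable]: "a \<in> borel_measurable M" "b \<in> borel_measurable M"
    unfolding a_def b_def by measurable
  have le2: "expectation a + expectation b \<le> 2"
  proof (rule expectation_le_2_of_tails[where C = "exp (B + \<bar>c\<bar>)"])
    fix r :: real assume r: "1 < r"
    define \<rho> where "\<rho> = (1 + 1 / r^2) / 2"
    have "1 / r^2 < 1" using r by (simp add: one_less_power)
    then have \<rho>: "0 < \<rho>" "\<rho> < 1"
      by (auto simp: \<rho>_def add_pos_nonneg)
    have W: "logcosh_cost (3 * ln r) = ln r + ln \<rho>"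
      using logcosh_cost_ln[OF r] by (simp add: \<rho>_def)
    have t: "0 < 3 * ln r" using r by simp
    have e: "exp (3 * ln r) = r^3" "exp (- (3 * ln r)) = 1 / r^3"
      using r exp_of_nat_mult[of 3 "ln r"] by (simp_all add: exp_minus divide_inverse)
    have "c - ln \<rho> \<in> S" using gt \<rho> by simp
    then obtain t0 where t0: "0 < t0" "1 / 2 < exp t0 * prob {x\<in>space M. f x \<le> c - ln \<rho> - logcosh_cost t0}"
      unfolding S_def by auto
    have compl: "prob {x\<in>space M. s < f x} = 1 - prob {x\<in>space M. f x \<le> s}" for s
      by (subst prob_compl[symmetric]) (auto intro!: arg_cong[where f = prob])
    \<comment> \<open>Levels above \<open>c\<close>: \<open>c + ln r\<close> for \<open>q\<close> against \<open>c - ln \<rho>\<close> for \<open>f\<close>.\<close>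
    have "prob {x\<in>space M. c + ln r < q x} \<le> 1 / r^3 * prob {x\<in>space M. c - ln \<rho> < f x}"
    proof (cases "1 / 2 \<le> prob {x\<in>space M. f x \<le> c - ln \<rho>}")
      case True
      from above[OF t this] show ?thesis by (simp add: W e)
    next
      case False
      have "prob {x\<in>space M. c + ln r < q x} \<le> 1 / r^3 * (1 / 2)"
        using across[OF t0(1) t t0(2)] by (simp add: W e)
      also have "\<dots> \<le> 1 / r^3 * prob {x\<in>space M. c - ln \<rho> < f x}"
        using False r by (intro mult_left_mono) (auto simp: compl)
      finally show ?thesis .
    qed
    moreover have "prob {x\<in>space M. c - ln \<rho> < f x} \<le> prob {x\<in>space M. a x \<le> \<rho>}"
    proof (intro finite_measure_mono subsetI)
      fix x assume "x \<in> {x\<in>space M. c - ln \<rho> < f x}"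
      then show "x \<in> {x\<in>space M. a x \<le> \<rho>}"
        using \<rho> ln_ge_iff[of \<rho> "c - f x"] by (simp add: a_def)
    qed measurable
    moreover have "{x\<in>space M. c + ln r < q x} = {x\<in>space M. r < b x}"
    proof (intro Collect_cong conj_cong refl)
      fix x show "c + ln r < q x \<longleftrightarrow> r < b x"
        using r exp_less_cancel_iff[of "ln r" "q x - c"] by (auto simp: b_def simp del: exp_less_cancel_iff)
    qed
    ultimately show "r^3 * prob {x\<in>space M. r < b x} \<le> prob {x\<in>space M. a x \<le> (1 + 1 / r^2) / 2}"
      using r unfolding \<rho>_def[symmetric] by (simp add: field_simps)
    \<comment> \<open>Levels below \<open>c\<close>: \<open>c + ln \<rho>\<close> for \<open>q\<close> against \<open>c - ln r\<close> for \<open>f\<close>.\<close>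
    have "c + ln \<rho> \<notin> S" using lt \<rho> by simp
    have "exp (3 * ln r) * prob {x\<in>space M. f x \<le> c + ln \<rho> - logcosh_cost (3 * ln r)} \<le> 1 / 2"
    proof (rule ccontr)
      assume "\<not> ?thesis"
      then have "c + ln \<rho> \<in> S"
        using t unfolding S_def by (intro CollectI exI[of _ "3 * ln r"]) simp
      with \<open>c + ln \<rho> \<notin> S\<close> show False ..
    qed
    then have "r^3 * prob {x\<in>space M. f x \<le> c - ln r} \<le> 1 / 2"
      by (simp add: e W)
    with below[OF t, of "c - ln r"] have "r^3 * prob {x\<in>space M. f x \<le> c - ln r} \<le> prob {x\<in>space M. q x \<le> c + ln \<rho>}"
      by (simp add: e W)
    moreover have "{x\<in>space M. q x \<le> c + ln \<rho>} = {x\<in>space M. b x \<le> \<rho>}"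
    proof (intro Collect_cong conj_cong refl)
      fix x show "q x \<le> c + ln \<rho> \<longleftrightarrow> b x \<le> \<rho>"
        using \<rho> ln_ge_iff[of \<rho> "q x - c"] by (auto simp: b_def)
    qed
    moreover have "prob {x\<in>space M. r < a x} \<le> prob {x\<in>space M. f x \<le> c - ln r}"
    proof (intro finite_measure_mono subsetI)
      fix x assume "x \<in> {x\<in>space M. r < a x}"
      then show "x \<in> {x\<in>space M. f x \<le> c - ln r}"
        using r exp_less_cancel_iff[of "ln r" "c - f x"] by (auto simp: a_def simp del: exp_less_cancel_iff)
    qed measurable
    then have "r^3 * prob {x\<in>space M. r < a x} \<le> r^3 * prob {x\<in>space M. f x \<le> c - ln r}"
      using r by (intro mult_left_mono) auto
    ultimately show "r^3 * prob {x\<in>space M. r < a x} \<le> prob {x\<in>space M. b x \<le> (1 + 1 / r^2) / 2}"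
      unfolding \<rho>_def[symmetric] by (metis (no_types, lifting) order_trans)
  next
    fix x assume "x \<in> space M"
    then show "0 \<le> a x \<and> a x \<le> exp (B + \<bar>c\<bar>)" "0 \<le> b x \<and> b x \<le> exp (B + \<bar>c\<bar>)"
      using f[of x] q[of x] by (auto simp: a_def b_def)
  qed auto
  have ea: "expectation a = exp c * expectation (\<lambda>x. exp (- f x))"
    unfolding a_def by (simp add: exp_diff exp_minus divide_inverse)
  have eb: "expectation b = exp (- c) * expectation (\<lambda>x. exp (q x))"
    unfolding b_def by (simp add: exp_diff exp_minus divide_inverse)
  have i: "integrable M (\<lambda>x. exp (q x))" "integrable M (\<lambda>x. exp (- f x))"
    using f q by (auto intro!: integrable_const_bound[where B = "exp B"] AE_I2 simp: abs_le_iff)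
  have p: "0 \<le> expectation a" "0 \<le> expectation b" by (auto simp: a_def b_def)
  have "expectation (\<lambda>x. exp (q x)) * expectation (\<lambda>x. exp (- f x)) = expectation a * expectation b"
    unfolding ea eb by (simp add: exp_minus)
  also have "\<dots> \<le> ((expectation a + expectation b) / 2)^2"
    using zero_le_power2[of "expectation a - expectation b"] by (simp add: power2_eq_square field_simps)
  also have "\<dots> \<le> 1"
    using le2 p by (simp add: power_le_one)
  finally have "expectation (\<lambda>x. exp (q x)) * expectation (\<lambda>x. exp (- f x)) \<le> 1" .
  then show ?thesis
    using i by (simp add: nn_integral_eq_integral ennreal_mult'[symmetric])
qed

section \<open>The Laplace and Cramer transforms\<close>

definition laplace :: "'a::euclidean_space measure \<Rightarrow> 'a \<Rightarrow> ennreal" where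
  "laplace M u = (\<integral>\<^sup>+ x. ennreal (exp (u \<bullet> x)) \<partial>M)"

text \<open>
In this form bounds on the Cramer transform are inequalities between nonnegative numbers, and
infinite values of the Laplace transform need no separate treatment.
\<close>
lemma cramer_transform_le_iff:
  "cramer_transform M v \<le> ereal c \<longleftrightarrow> (\<forall>u. ennreal (exp (v \<bullet> u - c)) \<le> laplace M u)"
proof -
  have "ereal (v \<bullet> u) - log_laplace M u \<le> ereal c \<longleftrightarrow> ennreal (exp (v \<bullet> u - c)) \<le> laplace M u" for u
  proof (cases "laplace M u")
    case (real r)
    show ?thesis
    proof (cases "r = 0")
      case True
      then show ?thesis using real by (simp add: log_laplace_def laplace_def[symmetric] ln_ennreal_def)
    next
      case False
      then have "v \<bullet> u - c \<le> ln r \<longleftrightarrow> exp (v \<bullet> u - c) \<le> r"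
        using real by (simp add: ln_ge_iff)
      then show ?thesis
        using real False by (auto simp: log_laplace_def laplace_def[symmetric] ln_ennreal_def)
    qed
  next
    case top
    then show ?thesis by (simp add: log_laplace_def laplace_def[symmetric] ln_ennreal_def)
  qed
  then show ?thesis by (simp add: cramer_transform_def SUP_le_iff)
qed

text \<open>
A supremum of affine functions is lower semicontinuous.
\<close>
lemma cramer_transform_measurable: "cramer_transform M \<in> borel_measurable borel"
proof (rule borel_measurableI_greater)
  fix y
  have "{x \<in> space borel. y < cramer_transform M x}
      = (\<Union>u. {x. y < ereal (x \<bullet> u) - log_laplace M u})"
    by (auto simp: cramer_transform_def less_SUP_iff)
  moreover have "open {x. y < ereal (x \<bullet> u) - log_laplace M u}" for u :: 'a
  proof (cases "log_laplace M u")
    case (real l)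
    have "{x. y < ereal (x \<bullet> u) - ereal l} = (\<lambda>x. ereal (x \<bullet> u - l)) -` {y<..}" by auto
    moreover have "open \<dots>" by (intro open_vimage continuous_intros open_greaterThan)
    ultimately show ?thesis by (simp add: real)
  qed simp_all
  ultimately show "{x \<in> space borel. y < cramer_transform M x} \<in> sets borel"
    by (auto intro!: borel_open)
qed

text \<open>
The difference of the two sides is \<open>(2 * sinh (z / 2))\<^sup>2 - z\<^sup>2\<close>. For \<open>y \<ge> 0\<close>, \<open>sinh y \<ge> y\<close> follows from
the quadratic Taylor bound, because \<open>(1 + y + y\<^sup>2/2) * (1 - y + y\<^sup>2/2) \<ge> 1\<close>.
\<close>
lemma two_plus_square_le_exp_plus_exp_minus:
  fixes z :: real
  shows "2 + z\<^sup>2 \<le> exp z + exp (- z)"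
proof -
  have sinh_ge: "2 * y \<le> exp y - exp (- y)" if "0 \<le> y" for y :: real
  proof -
    have "1 \<le> (1 + y + y\<^sup>2 / 2) * (1 - y + y\<^sup>2 / 2)"
      using zero_le_power2[of "y\<^sup>2 / 2"] by (simp add: power2_eq_square algebra_simps)
    moreover have e: "1 + y + y\<^sup>2 / 2 \<le> exp y"
      using that by (rule exp_lower_Taylor_quadratic)
    moreover have "0 \<le> 1 - y + y\<^sup>2 / 2"
      using zero_le_power2[of "y - 1"] by (simp add: power2_eq_square algebra_simps)
    ultimately have "1 \<le> exp y * (1 - y + y\<^sup>2 / 2)"
      by (meson mult_right_mono order_trans)
    then have "exp (- y) \<le> 1 - y + y\<^sup>2 / 2"
      by (simp add: exp_minus inverse_eq_divide divide_le_eq mult.commute)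
    with e show ?thesis by simp
  qed
  have "z\<^sup>2 = (2 * \<bar>z / 2\<bar>)\<^sup>2" by (simp add: power2_eq_square)
  also have "\<dots> \<le> (exp \<bar>z / 2\<bar> - exp (- \<bar>z / 2\<bar>))\<^sup>2"
    by (intro power_mono sinh_ge) auto
  also have "\<dots> = exp z + exp (- z) - 2"
    by (cases "0 \<le> z") (simp_all add: power2_eq_square algebra_simps flip: exp_add)
  finally show ?thesis by simp
qed

text \<open>
As a function of \<open>z powr p\<close>, \<open>exp z\<close> lies above its tangent at \<open>z = m\<close> as soon as \<open>m \<ge> p\<close>: for \<open>m = p\<close>
this is \<open>y powr p \<le> exp (p * (y - 1))\<close> with \<open>y = z / m\<close>, and convexity of \<open>exp\<close> gives larger \<open>m\<close>.
\<close>
lemma exp_ge_power_tangent: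
  fixes m p z :: real
  assumes "0 < p" "p \<le> m" "0 \<le> z"
  shows "exp m + exp m * (m / p) * (z powr p / m powr p) \<le> exp z + exp m * (m / p)"
proof -
  define s where "s = z / m - 1"
  have "z powr p / m powr p = (z / m) powr p"
    using assms by (simp add: powr_divide)
  also have "\<dots> \<le> exp (p * s)"
  proof (cases "z = 0")
    case False
    then have "(z / m) powr p = exp (p * ln (z / m))" using assms by (simp add: powr_def)
    also have "\<dots> \<le> exp (p * s)"
      using False assms ln_le_minus_one[of "z / m"] by (simp add: s_def)
    finally show ?thesis .
  qed simp
  also have "exp (p * s) \<le> (1 - p / m) * exp 0 + (p / m) * exp (m * s)"
    using convex_onD[OF exp_convex, of "p / m" 0 "m * s"] assms by simp
  finally have "z powr p / m powr p \<le> (1 - p / m) + (p / m) * exp (m * s)" by simp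
  then have "exp m * (m / p) * (z powr p / m powr p)
      \<le> exp m * (m / p) * ((1 - p / m) + (p / m) * exp (m * s))"
    using assms by (intro mult_left_mono) auto
  also have "\<dots> = exp m * (m / p) - exp m + exp (m + m * s)"
    using assms by (simp add: exp_add field_simps)
  also have "m + m * s = z" using assms by (simp add: s_def field_simps)
  finally show ?thesis by simp
qed

locale borel_prob_space = prob_space M for M :: "'a::euclidean_space measure" +
  assumes sets_M: "sets M = sets borel"
begin

lemma laplace_0: "laplace M 0 = 1"
  by (simp add: laplace_def emeasure_space_1)

lemma cramer_transform_nonneg: "0 \<le> cramer_transform M v"
proof -
  have "0 = ereal (v \<bullet> 0) - log_laplace M 0"
    by (simp add: log_laplace_def laplace_def[symmetric] ln_ennreal_def laplace_0 del: inner_zero_left)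
  also have "\<dots> \<le> cramer_transform M v"
    unfolding cramer_transform_def by (rule SUP_upper) simp
  finally show ?thesis .
qed

lemma symmetric_distr_uminus:
  assumes "symmetric_measure M"
  shows "distr M borel uminus = M"
proof (rule measure_eqI)
  fix A assume "A \<in> sets (distr M borel uminus)"
  then have A: "A \<in> sets borel" by simp
  have um: "uminus \<in> measurable M borel"
    using sets_M by (simp cong: measurable_cong_sets)
  have "uminus -` A = uminus ` A" by (auto simp: image_iff) (metis minus_minus)
  moreover have "space M = UNIV" using sets_eq_imp_space_eq[OF sets_M] by simp
  ultimately show "emeasure (distr M borel uminus) A = emeasure M A"
    using assms A um by (simp add: emeasure_distr emeasure_eq_measure symmetric_measure_def)
qed (simp add: sets_M)

lemma laplace_uminus:
  assumes "symmetric_measure M"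
  shows "laplace M (- u) = laplace M u"
proof -
  have um: "uminus \<in> measurable M borel"
    using sets_M by (simp cong: measurable_cong_sets)
  have "laplace M u = (\<integral>\<^sup>+ x. ennreal (exp (u \<bullet> x)) \<partial>distr M borel uminus)"
    by (simp add: laplace_def symmetric_distr_uminus[OF assms])
  also have "\<dots> = laplace M (- u)"
    unfolding laplace_def using um by (subst nn_integral_distr) auto
  finally show ?thesis by simp
qed

lemma measurable_inner_M [measurable]: "(\<lambda>x. u \<bullet> x) \<in> borel_measurable M"
  using sets_M by (simp cong: measurable_cong_sets)

lemma double_laplace:
  assumes "symmetric_measure M"
  shows "2 * laplace M u = (\<integral>\<^sup>+ x. ennreal (exp (u \<bullet> x) + exp (- (u \<bullet> x))) \<partial>M)"
proof -
  have "2 * laplace M u = laplace M u + laplace M (- u)"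
    by (simp add: laplace_uminus[OF assms] mult_2)
  also have "\<dots> = (\<integral>\<^sup>+ x. ennreal (exp (u \<bullet> x)) + ennreal (exp (- (u \<bullet> x))) \<partial>M)"
    unfolding laplace_def by (subst nn_integral_add) auto
  finally show ?thesis by (simp add: ennreal_plus)
qed

lemma laplace_ge_quadratic:
  assumes "symmetric_measure M" "isotropic M"
  shows "ennreal (1 + (norm u)\<^sup>2 / 2) \<le> laplace M u"
proof -
  have int: "integrable M (\<lambda>x. (u \<bullet> x)\<^sup>2)" "(\<integral>x. (u \<bullet> x)\<^sup>2 \<partial>M) = (norm u)\<^sup>2"
    using assms(2) by (auto simp: isotropic_def)
  have "2 * ennreal (1 + (norm u)\<^sup>2 / 2) = ennreal (2 + (norm u)\<^sup>2)"
    by (subst ennreal_numeral[symmetric], subst ennreal_mult[symmetric]) (auto simp: algebra_simps)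
  also have "\<dots> = ennreal (\<integral>x. 2 + (u \<bullet> x)\<^sup>2 \<partial>M)"
    using int by (subst Bochner_Integration.integral_add) (auto simp: prob_space)
  also have "\<dots> = (\<integral>\<^sup>+ x. ennreal (2 + (u \<bullet> x)\<^sup>2) \<partial>M)"
    using int by (intro nn_integral_eq_integral[symmetric]) auto
  also have "\<dots> \<le> 2 * laplace M u"
    unfolding double_laplace[OF assms(1)] by (intro nn_integral_mono ennreal_leI two_plus_square_le_exp_plus_exp_minus)
  finally show ?thesis by (subst (asm) ennreal_mult_le_mult_iff) auto
qed

lemma laplace_ge_1:
  assumes "symmetric_measure M" "isotropic M"
  shows "1 \<le> laplace M u"
proof -
  have "ennreal 1 \<le> ennreal (1 + (norm u)\<^sup>2 / 2)" by (intro ennreal_leI) simp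
  also note laplace_ge_quadratic[OF assms]
  finally show ?thesis by simp
qed

text \<open>
A large \<open>p\<close>-th moment forces a large exponential moment: the tangent inequality at \<open>m\<close> can be
integrated, and its terms other than \<open>exp m\<close> cancel. By symmetry \<open>exp \<bar>u \<bullet> x\<bar>\<close> has at most twice the
integral of \<open>exp (u \<bullet> x)\<close>.
\<close>
lemma laplace_ge_exp_of_moment:
  assumes "symmetric_measure M" "0 < p" "p \<le> m" and moment: "ennreal (m powr p) \<le> abs_moment M p u"
  shows "ennreal (exp m / 2) \<le> laplace M u"
proof -
  let ?k = "exp m * (m / p)"
  have k: "0 \<le> ?k" using assms by simp
  have "ennreal (exp m) + ennreal ?k = ennreal (exp m) + ennreal (?k / m powr p) * ennreal (m powr p)"
    using assms by (simp flip: ennreal_mult')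
  also have "\<dots> \<le> ennreal (exp m) + ennreal (?k / m powr p) * abs_moment M p u"
    using moment by (intro add_left_mono mult_left_mono) auto
  also have "\<dots> = (\<integral>\<^sup>+ x. ennreal (exp m) + ennreal (?k / m powr p) * ennreal (\<bar>u \<bullet> x\<bar> powr p) \<partial>M)"
    unfolding abs_moment_def
    by (subst nn_integral_add) (auto simp: nn_integral_cmult emeasure_space_1)
  also have "\<dots> \<le> (\<integral>\<^sup>+ x. ennreal (exp (u \<bullet> x) + exp (- (u \<bullet> x))) + ennreal ?k \<partial>M)"
  proof (intro nn_integral_mono)
    fix x
    have "exp m + ?k * (\<bar>u \<bullet> x\<bar> powr p / m powr p) \<le> exp \<bar>u \<bullet> x\<bar> + ?k"
      using assms by (intro exp_ge_power_tangent) auto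
    also have "exp \<bar>u \<bullet> x\<bar> \<le> exp (u \<bullet> x) + exp (- (u \<bullet> x))"
      by (simp add: abs_if)
    finally have le: "exp m + ?k / m powr p * \<bar>u \<bullet> x\<bar> powr p \<le> exp (u \<bullet> x) + exp (- (u \<bullet> x)) + ?k"
      by simp
    have "ennreal (exp m) + ennreal (?k / m powr p) * ennreal (\<bar>u \<bullet> x\<bar> powr p)
        = ennreal (exp m + ?k / m powr p * \<bar>u \<bullet> x\<bar> powr p)"
      using assms by (subst ennreal_mult[symmetric], simp, simp, subst ennreal_plus[symmetric]) auto
    also have "\<dots> \<le> ennreal (exp (u \<bullet> x) + exp (- (u \<bullet> x)) + ?k)"
      by (rule ennreal_leI[OF le])
    also have "\<dots> = ennreal (exp (u \<bullet> x) + exp (- (u \<bullet> x))) + ennreal ?k"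
      using k by (intro ennreal_plus) auto
    finally show "ennreal (exp m) + ennreal (?k / m powr p) * ennreal (\<bar>u \<bullet> x\<bar> powr p)
        \<le> ennreal (exp (u \<bullet> x) + exp (- (u \<bullet> x))) + ennreal ?k" .
  qed
  also have "\<dots> = 2 * laplace M u + ennreal ?k"
    by (subst nn_integral_add) (auto simp: double_laplace[OF assms(1)] emeasure_space_1)
  finally have "ennreal (exp m) \<le> 2 * laplace M u"
    by (simp add: add.commute ennreal_add_left_cancel_le)
  moreover have "ennreal (exp m) = 2 * ennreal (exp m / 2)"
    by (subst ennreal_numeral[symmetric], subst ennreal_mult[symmetric]) auto
  ultimately show ?thesis by (simp add: ennreal_mult_le_mult_iff)
qed

end

section \<open>Sublevel sets of the Cramer transform and moment bodies\<close>

lemma power_self_le_fact_exp: "real k ^ k \<le> fact k * exp (real k)"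
proof -
  have "real k ^ k /\<^sub>R fact k \<le> exp (real k)"
    unfolding exp_def using summable_exp_generic[of "real k"]
    by (intro sum_le_suminf[of _ "{k}", simplified]) auto
  then show ?thesis by (simp add: field_simps)
qed

lemma two_exp_quarter_le_exp:
  fixes p s :: real
  assumes "2 \<le> p" "0 \<le> s" "s \<le> p / 4"
  shows "2 * exp s + 2 \<le> exp p"
proof -
  have "13 / 8 \<le> exp (1 / 2 :: real)"
    using exp_lower_Taylor_quadratic[of "1 / 2 :: real"] by (simp add: power2_eq_square)
  then have "(13 / 8) ^ 3 \<le> exp (1 / 2 :: real) ^ 3"
    by (intro power_mono) auto
  also have "\<dots> = exp (3 / 2)" by (simp flip: exp_of_nat_mult)
  also have "\<dots> \<le> exp (p - s)" using assms by simp
  finally have "4 * exp s \<le> exp (p - s) * exp s"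
    by (intro mult_right_mono) (auto simp: power3_eq_cube)
  moreover have "1 \<le> exp s" using assms by simp
  moreover have "exp (p - s) * exp s = exp p" by (simp flip: exp_add)
  ultimately show ?thesis by linarith
qed

context borel_prob_space
begin

lemma cramer_transform_0_le:
  assumes "symmetric_measure M" "isotropic M"
  shows "cramer_transform M 0 \<le> 0"
  using laplace_ge_1[OF assms] cramer_transform_le_iff[of M 0 0] by (simp add: zero_ereal_def)

text \<open>
This is convexity between \<open>v\<close> and the origin, where the transform vanishes because the Laplace
transform is at least \<open>1\<close>.
\<close>
lemma cramer_transform_scale:
  assumes "symmetric_measure M" "isotropic M" and l: "0 \<le> l" "l \<le> 1"
    and "cramer_transform M v \<le> ereal c"
  shows "cramer_transform M (l *\<^sub>R v) \<le> ereal (l * c)"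
  unfolding cramer_transform_le_iff
proof
  fix u
  have "exp ((l *\<^sub>R v) \<bullet> u - l * c) = exp (l * (v \<bullet> u - c))" by (simp add: algebra_simps)
  also have "\<dots> \<le> max 1 (exp (v \<bullet> u - c))"
  proof (cases "v \<bullet> u \<le> c")
    case True
    then have "l * (v \<bullet> u - c) \<le> 0" using l by (intro mult_nonneg_nonpos) auto
    then have "exp (l * (v \<bullet> u - c)) \<le> 1" by (simp only: exp_le_one_iff)
    then show ?thesis by (rule max.coboundedI1)
  next
    case False
    then have "l * (v \<bullet> u - c) \<le> v \<bullet> u - c"
      using l by (intro mult_left_le_one_le) auto
    then have "exp (l * (v \<bullet> u - c)) \<le> exp (v \<bullet> u - c)" by (simp only: exp_le_cancel_iff)
    then show ?thesis by (rule max.coboundedI2)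
  qed
  finally have "ennreal (exp ((l *\<^sub>R v) \<bullet> u - l * c)) \<le> ennreal (max 1 (exp (v \<bullet> u - c)))"
    by (rule ennreal_leI)
  also have "\<dots> \<le> laplace M u"
    using laplace_ge_1[OF assms(1,2), of u] assms(5) unfolding cramer_transform_le_iff
    by (simp add: max_def)
  finally show "ennreal (exp ((l *\<^sub>R v) \<bullet> u - l * c)) \<le> laplace M u" .
qed

lemma cramer_transform_midpoint:
  assumes "cramer_transform M (2 *\<^sub>R x) \<le> ereal (2 * a)" "cramer_transform M (2 *\<^sub>R y) \<le> ereal (2 * b)"
  shows "cramer_transform M (x + y) \<le> ereal (a + b)"
  unfolding cramer_transform_le_iff
proof
  fix u
  have "exp ((x + y) \<bullet> u - (a + b)) \<le> exp (max ((2 *\<^sub>R x) \<bullet> u - 2 * a) ((2 *\<^sub>R y) \<bullet> u - 2 * b))"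
    by (simp add: inner_add_left)
  then have "ennreal (exp ((x + y) \<bullet> u - (a + b)))
      \<le> ennreal (exp (max ((2 *\<^sub>R x) \<bullet> u - 2 * a) ((2 *\<^sub>R y) \<bullet> u - 2 * b)))"
    by (rule ennreal_leI)
  also have "\<dots> \<le> laplace M u"
    using assms unfolding cramer_transform_le_iff by (auto simp: max_def)
  finally show "ennreal (exp ((x + y) \<bullet> u - (a + b))) \<le> laplace M u" .
qed

lemma abs_moment_2:
  assumes "isotropic M"
  shows "abs_moment M 2 u = ennreal ((norm u)\<^sup>2)"
proof -
  have "abs_moment M 2 u = (\<integral>\<^sup>+ x. ennreal ((u \<bullet> x)\<^sup>2) \<partial>M)"
    unfolding abs_moment_def by (intro nn_integral_cong) (use powr_realpow'[of _ 2] in simp)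
  also have "\<dots> = ennreal (\<integral>x. (u \<bullet> x)\<^sup>2 \<partial>M)"
    using assms by (intro nn_integral_eq_integral) (auto simp: isotropic_def)
  also have "\<dots> = ennreal ((norm u)\<^sup>2)"
    using assms by (simp add: isotropic_def)
  finally show ?thesis .
qed

text \<open>
With \<open>r = norm u\<close>, the Laplace transform at \<open>u\<close> is at least \<open>1 + r\<^sup>2 / 2\<close>, which suffices for \<open>r \<le> 2\<close>
but grows too slowly beyond; there the second moment yields the bound \<open>exp r / 2\<close>, which beats
\<open>exp (r / 2)\<close>.
\<close>
lemma cramer_transform_le_quadratic:
  assumes "symmetric_measure M" "isotropic M" "norm y \<le> 1 / 2"
  shows "cramer_transform M y \<le> ereal (3 / 2 * (norm y)\<^sup>2)"
  unfolding cramer_transform_le_iff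
proof
  fix u :: 'a
  define r where "r = norm u"
  have yu: "y \<bullet> u \<le> norm y * r" unfolding r_def by (rule norm_cauchy_schwarz)
  show "ennreal (exp (y \<bullet> u - 3 / 2 * (norm y)\<^sup>2)) \<le> laplace M u"
  proof (cases "r \<le> 2")
    case True
    define w where "w = r\<^sup>2 / 6"
    have "r\<^sup>2 \<le> 2\<^sup>2" using True by (intro power_mono) (auto simp: r_def)
    then have w: "0 \<le> w" "w \<le> 2 / 3" by (auto simp: w_def)
    have "y \<bullet> u - 3 / 2 * (norm y)\<^sup>2 \<le> w"
      using yu zero_le_power2[of "3 * norm y - r"] by (simp add: w_def power2_eq_square algebra_simps)
    then have "exp (y \<bullet> u - 3 / 2 * (norm y)\<^sup>2) \<le> exp w" by simp
    also have "exp w \<le> 1 / (1 - w)"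
      using exp_ge_add_one_self[of "- w"] w by (simp add: exp_minus field_simps)
    also have "\<dots> \<le> 1 + 3 * w"
    proof -
      have "0 \<le> w * (2 - 3 * w)" using w by simp
      then have "1 \<le> (1 + 3 * w) * (1 - w)" by (simp add: algebra_simps)
      then show ?thesis using w by (simp add: divide_le_eq)
    qed
    finally have "ennreal (exp (y \<bullet> u - 3 / 2 * (norm y)\<^sup>2)) \<le> ennreal (1 + r\<^sup>2 / 2)"
      by (intro ennreal_leI) (simp add: w_def)
    also have "\<dots> \<le> laplace M u" unfolding r_def by (rule laplace_ge_quadratic[OF assms(1,2)])
    finally show ?thesis .
  next
    case False
    have "norm y * r \<le> 1 / 2 * r" using assms(3) False by (intro mult_right_mono) auto
    then have "y \<bullet> u - 3 / 2 * (norm y)\<^sup>2 + 1 \<le> r"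
      using yu False zero_le_power2[of "norm y"] by linarith
    then have "exp (y \<bullet> u - 3 / 2 * (norm y)\<^sup>2) * exp 1 \<le> exp r" by (simp flip: exp_add)
    moreover have "exp (y \<bullet> u - 3 / 2 * (norm y)\<^sup>2) * 2 \<le> exp (y \<bullet> u - 3 / 2 * (norm y)\<^sup>2) * exp 1"
      using exp_ge_add_one_self[of "1::real"] by (intro mult_left_mono) auto
    ultimately have "exp (y \<bullet> u - 3 / 2 * (norm y)\<^sup>2) \<le> exp r / 2"
      by linarith
    then have "ennreal (exp (y \<bullet> u - 3 / 2 * (norm y)\<^sup>2)) \<le> ennreal (exp r / 2)"
      by (rule ennreal_leI)
    also have "\<dots> \<le> laplace M u"
      using False by (intro laplace_ge_exp_of_moment[OF assms(1), of 2])
        (auto simp: abs_moment_2[OF assms(2)] powr_realpow'[of _ 2, simplified] r_def)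
    finally show ?thesis .
  qed
qed

text \<open>
For \<open>z \<in> Zp_body p M\<close> the number \<open>m = \<bar>u \<bullet> z\<bar>\<close> is at most the \<open>p\<close>-th norm of \<open>\<lambda>x. u \<bullet> x\<close>. If
\<open>m \<le> p\<close> there is nothing to prove, and otherwise the Laplace transform at \<open>u\<close> is at least
\<open>exp m / 2\<close>.
\<close>
lemma cramer_transform_le_on_Zp_body:
  assumes "symmetric_measure M" "isotropic M" "1 \<le> p" "z \<in> Zp_body p M"
  shows "cramer_transform M z \<le> ereal p"
  unfolding cramer_transform_le_iff
proof
  fix u
  define m where "m = \<bar>u \<bullet> z\<bar>"
  have zu: "z \<bullet> u \<le> m" by (simp add: m_def inner_commute)
  show "ennreal (exp (z \<bullet> u - p)) \<le> laplace M u"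
  proof (cases "m \<le> p")
    case True
    then have "ennreal (exp (z \<bullet> u - p)) \<le> ennreal 1"
      using zu by (intro ennreal_leI) simp
    also have "\<dots> \<le> laplace M u" using laplace_ge_1[OF assms(1,2)] by simp
    finally show ?thesis .
  next
    case False
    have "2 \<le> exp p" using exp_ge_add_one_self[of p] assms(3) by linarith
    then have "2 * exp (z \<bullet> u - p) \<le> exp p * exp (z \<bullet> u - p)" by (intro mult_right_mono) auto
    also have "\<dots> \<le> exp m" using zu by (simp flip: exp_add)
    finally have "ennreal (exp (z \<bullet> u - p)) \<le> ennreal (exp m / 2)" by (intro ennreal_leI) simp
    also have "\<dots> \<le> laplace M u"
      using False assms by (intro laplace_ge_exp_of_moment[OF assms(1), of p])
        (auto simp: Zp_body_def m_def)
    finally show ?thesis .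
  qed
qed

lemma abs_moment_le_of_regular:
  assumes "regular_measure \<alpha> M" "0 < \<alpha>" "2 \<le> p" "p \<le> k" "0 < m"
    and "abs_moment M p u \<le> ennreal (m powr p)"
  shows "abs_moment M k u \<le> ennreal ((\<alpha> * (k / p) * m) powr k)"
proof -
  obtain a where a: "abs_moment M p u = ennreal a" "0 \<le> a" "a \<le> m powr p"
    using assms by (cases "abs_moment M p u") (auto simp: top_unique)
  have "a powr (1 / p) \<le> (m powr p) powr (1 / p)"
    using a assms by (intro powr_mono2) auto
  then have am: "a powr (1 / p) \<le> m" using assms by (simp add: powr_powr)
  have "ennreal_powr (abs_moment M k u) (1 / k)
      \<le> ennreal (\<alpha> * (k / p)) * ennreal_powr (abs_moment M p u) (1 / p)"
    using assms by (auto simp: regular_measure_def)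
  also have "\<dots> = ennreal (\<alpha> * (k / p) * a powr (1 / p))"
    using a assms by (simp only: ennreal_powr_def ennreal_neq_top if_False enn2real_ennreal) (simp flip: ennreal_mult')
  also have "\<dots> \<le> ennreal (\<alpha> * (k / p) * m)"
    using am assms by (intro ennreal_leI mult_left_mono) auto
  finally have le: "ennreal_powr (abs_moment M k u) (1 / k) \<le> ennreal (\<alpha> * (k / p) * m)" .
  then obtain b where b: "abs_moment M k u = ennreal b" "0 \<le> b"
    by (cases "abs_moment M k u") (auto simp: ennreal_powr_def top_unique)
  with le have "b powr (1 / k) \<le> \<alpha> * (k / p) * m"
    using assms by (simp add: ennreal_powr_def ennreal_le_iff)
  then have "(b powr (1 / k)) powr k \<le> (\<alpha> * (k / p) * m) powr k"
    using assms by (intro powr_mono2) auto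
  then show ?thesis using b assms by (simp add: powr_powr ennreal_leI)
qed

text \<open>
The exponential is expanded into its power series in \<open>s * \<bar>u \<bullet> x\<bar>\<close>. The terms of order \<open>k < p\<close> are
controlled by \<open>y ^ k \<le> 1 + y powr p\<close>. For \<open>k \<ge> p\<close> regularity bounds the \<open>k\<close>-th moment, and by
\<open>k ^ k \<le> fact k * exp k\<close> the scaling \<open>s = p / (2 * exp 1 * \<alpha> * m)\<close> is just small enough to make the
terms at most \<open>(1/2) ^ k\<close>.
\<close>
lemma laplace_le_exp_of_regular:
  assumes reg: "regular_measure \<alpha> M" and "1 \<le> \<alpha>" "2 \<le> p" "0 < m"
    and mom: "abs_moment M p u \<le> ennreal (m powr p)"
  shows "laplace M ((p / (2 * exp 1 * \<alpha> * m)) *\<^sub>R u) \<le> ennreal (exp p)"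
proof -
  define s where "s = p / (2 * exp 1 * \<alpha> * m)"
  have s: "0 \<le> s" using assms by (simp add: s_def)
  have "2 \<le> exp (1::real)" using exp_ge_add_one_self[of "1::real"] by simp
  then have "2 * 2 * 1 \<le> 2 * exp 1 * \<alpha>" using assms by (intro mult_mono) auto
  then have "p / (2 * exp 1 * \<alpha>) \<le> p / 4" using assms by (intro divide_left_mono) auto
  then have sm: "0 \<le> s * m" "s * m \<le> p / 4"
    using assms by (auto simp: s_def)
  have coeff: "(\<integral>\<^sup>+ x. ennreal ((s * \<bar>u \<bullet> x\<bar>) ^ k / fact k) \<partial>M)
      \<le> ennreal (2 * ((s * m) ^ k / fact k) + (1 / 2) ^ k)" for k
  proof (cases "p \<le> real k")
    case True
    then have k: "0 < k" using assms by (cases k) auto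
    have "(\<integral>\<^sup>+ x. ennreal ((s * \<bar>u \<bullet> x\<bar>) ^ k / fact k) \<partial>M)
        = (\<integral>\<^sup>+ x. ennreal (s ^ k / fact k) * ennreal (\<bar>u \<bullet> x\<bar> powr real k) \<partial>M)"
      using s k by (intro nn_integral_cong)
        (auto simp: power_mult_distrib powr_realpow' simp flip: ennreal_mult)
    also have "\<dots> = ennreal (s ^ k / fact k) * abs_moment M (real k) u"
      unfolding abs_moment_def by (intro nn_integral_cmult) auto
    also have "\<dots> \<le> ennreal (s ^ k / fact k) * ennreal ((\<alpha> * (real k / p) * m) powr real k)"
      using assms True by (intro mult_left_mono abs_moment_le_of_regular[OF reg]) auto
    also have "\<dots> = ennreal ((real k / (2 * exp 1)) ^ k / fact k)"
    proof -
      have "s ^ k / fact k * (\<alpha> * (real k / p) * m) powr real k = (s * (\<alpha> * (real k / p) * m)) ^ k / fact k"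
        using assms k by (subst powr_realpow) (auto simp only: power_mult_distrib[of s] times_divide_eq_left intro!: mult_pos_pos divide_pos_pos of_nat_0_less_iff[THEN iffD2])
      also have "s * (\<alpha> * (real k / p) * m) = real k / (2 * exp 1)"
        using assms by (simp add: s_def)
      finally show ?thesis using s by (simp flip: ennreal_mult')
    qed
    also have "\<dots> \<le> ennreal ((1 / 2) ^ k)"
    proof (intro ennreal_leI)
      have "exp (real k) = exp 1 ^ k" by (simp flip: exp_of_nat_mult)
      then show "(real k / (2 * exp 1)) ^ k / fact k \<le> (1 / 2) ^ k"
        using power_self_le_fact_exp[of k] by (simp add: power_divide power_mult_distrib field_simps)
    qed
    also have "\<dots> \<le> ennreal (2 * ((s * m) ^ k / fact k) + (1 / 2) ^ k)"
      using sm by (intro ennreal_leI) simp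
    finally show ?thesis .
  next
    case False
    let ?c = "(s * m) ^ k / fact k"
    have c: "0 \<le> ?c" using sm by simp
    have d: "0 \<le> ?c / m powr p" using c by (rule divide_nonneg_nonneg) simp
    have pt: "(s * \<bar>u \<bullet> x\<bar>) ^ k / fact k \<le> ?c + ?c / m powr p * \<bar>u \<bullet> x\<bar> powr p" for x
    proof -
      define y where "y = \<bar>u \<bullet> x\<bar> / m"
      have y: "0 \<le> y" "\<bar>u \<bullet> x\<bar> = m * y" using assms by (auto simp: y_def)
      have "y ^ k \<le> 1 + y powr p"
      proof (cases "y \<le> 1")
        case True
        then show ?thesis using y power_le_one[of y k] by (simp add: add_increasing2)
      next
        case F: False
        then have "y ^ k = y powr real k" by (simp add: powr_realpow)
        also have "\<dots> \<le> y powr p" using F False by (intro powr_mono) auto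
        finally show ?thesis by simp
      qed
      then have "?c * y ^ k \<le> ?c * (1 + y powr p)" using c by (rule mult_left_mono)
      moreover have "(s * \<bar>u \<bullet> x\<bar>) ^ k / fact k = ?c * y ^ k"
        unfolding y by (simp add: power_mult_distrib)
      moreover have "?c / m powr p * \<bar>u \<bullet> x\<bar> powr p = ?c * y powr p"
        unfolding y(2) using y(1) assms by (simp add: powr_mult)
      ultimately show ?thesis by (simp add: distrib_left)
    qed
    have "(\<integral>\<^sup>+ x. ennreal ((s * \<bar>u \<bullet> x\<bar>) ^ k / fact k) \<partial>M)
        \<le> (\<integral>\<^sup>+ x. ennreal ?c + ennreal (?c / m powr p) * ennreal (\<bar>u \<bullet> x\<bar> powr p) \<partial>M)"
    proof (intro nn_integral_mono)
      fix x
      have "ennreal ((s * \<bar>u \<bullet> x\<bar>) ^ k / fact k) \<le> ennreal (?c + ?c / m powr p * \<bar>u \<bullet> x\<bar> powr p)"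
        using pt by (rule ennreal_leI)
      also have "\<dots> = ennreal ?c + ennreal (?c / m powr p) * ennreal (\<bar>u \<bullet> x\<bar> powr p)"
        by (simp only: ennreal_plus[OF c mult_nonneg_nonneg[OF d powr_ge_zero]] ennreal_mult[OF d powr_ge_zero])
      finally show "ennreal ((s * \<bar>u \<bullet> x\<bar>) ^ k / fact k)
          \<le> ennreal ?c + ennreal (?c / m powr p) * ennreal (\<bar>u \<bullet> x\<bar> powr p)" .
    qed
    also have "\<dots> = ennreal ?c + ennreal (?c / m powr p) * abs_moment M p u"
      unfolding abs_moment_def
      by (subst nn_integral_add) (auto simp: nn_integral_cmult emeasure_space_1)
    also have "\<dots> \<le> ennreal ?c + ennreal (?c / m powr p) * ennreal (m powr p)"
      using mom by (intro add_left_mono mult_left_mono) auto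
    also have "\<dots> = ennreal ?c + ennreal ?c"
      unfolding ennreal_mult[OF d powr_ge_zero, symmetric] using assms by simp
    also have "\<dots> \<le> ennreal (2 * ?c + (1 / 2) ^ k)"
      unfolding ennreal_plus[OF c c, symmetric] by (intro ennreal_leI) simp
    finally show ?thesis .
  qed
  have "laplace M (s *\<^sub>R u) \<le> (\<integral>\<^sup>+ x. (\<Sum>k. ennreal ((s * \<bar>u \<bullet> x\<bar>) ^ k / fact k)) \<partial>M)"
    unfolding laplace_def
  proof (intro nn_integral_mono)
    fix x
    have "(\<lambda>k. (s * \<bar>u \<bullet> x\<bar>) ^ k / fact k) sums exp (s * \<bar>u \<bullet> x\<bar>)"
      using exp_converges[of "s * \<bar>u \<bullet> x\<bar>"] by (simp add: divide_inverse mult.commute)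
    then have "(\<Sum>k. ennreal ((s * \<bar>u \<bullet> x\<bar>) ^ k / fact k)) = ennreal (exp (s * \<bar>u \<bullet> x\<bar>))"
      using s by (intro suminf_ennreal_eq) auto
    moreover have "(s *\<^sub>R u) \<bullet> x \<le> s * \<bar>u \<bullet> x\<bar>"
      using s by (simp add: mult_left_mono)
    ultimately show "ennreal (exp ((s *\<^sub>R u) \<bullet> x)) \<le> (\<Sum>k. ennreal ((s * \<bar>u \<bullet> x\<bar>) ^ k / fact k))"
      by (simp add: ennreal_leI)
  qed
  also have "\<dots> = (\<Sum>k. \<integral>\<^sup>+ x. ennreal ((s * \<bar>u \<bullet> x\<bar>) ^ k / fact k) \<partial>M)"
    by (intro nn_integral_suminf) auto
  also have "\<dots> \<le> (\<Sum>k. ennreal (2 * ((s * m) ^ k / fact k) + (1 / 2) ^ k))"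
    by (intro suminf_le coeff summableI)
  also have "\<dots> = ennreal (2 * exp (s * m) + 2)"
  proof (intro suminf_ennreal_eq)
    have "(\<lambda>k. (s * m) ^ k / fact k) sums exp (s * m)"
      using exp_converges[of "s * m"] by (simp add: divide_inverse mult.commute)
    moreover have "(\<lambda>k. (1 / 2 :: real) ^ k) sums 2"
      using geometric_sums[of "1 / 2 :: real"] by simp
    ultimately show "(\<lambda>k. 2 * ((s * m) ^ k / fact k) + (1 / 2) ^ k) sums (2 * exp (s * m) + 2)"
      by (intro sums_add sums_mult)
  qed (use sm in auto)
  also have "\<dots> \<le> ennreal (exp p)"
    using two_exp_quarter_le_exp[OF \<open>2 \<le> p\<close> sm] by (rule ennreal_leI)
  finally show ?thesis by (simp add: s_def)
qed

text \<open>
The supremum that defines the transform is tested at the multiple of \<open>w\<close> for which the preceding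
lemma applies. Working with every \<open>m\<close> strictly above the \<open>p\<close>-th norm of \<open>\<lambda>x. w \<bullet> x\<close> keeps that
multiple well defined even if this norm is \<open>0\<close>.
\<close>
lemma cramer_sublevel_subset_Zp_body:
  assumes reg: "regular_measure \<alpha> M" and "1 \<le> \<alpha>" "2 \<le> p"
    and v: "cramer_transform M v \<le> ereal p"
  shows "v /\<^sub>R (4 * exp 1 * \<alpha>) \<in> Zp_body p M"
proof -
  let ?K = "4 * exp 1 * \<alpha>"
  have K: "0 < ?K" using assms by simp
  have bound: "w \<bullet> v \<le> ?K * m" if "0 < m" "abs_moment M p w \<le> ennreal (m powr p)" for w m
  proof -
    let ?s = "p / (2 * exp 1 * \<alpha> * m)"
    have "ennreal (exp (v \<bullet> (?s *\<^sub>R w) - p)) \<le> laplace M (?s *\<^sub>R w)"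
      using v unfolding cramer_transform_le_iff by blast
    also have "\<dots> \<le> ennreal (exp p)"
      using assms that by (intro laplace_le_exp_of_regular[OF reg])
    finally have "?s * (w \<bullet> v) \<le> 2 * p" by (simp add: inner_commute)
    then show ?thesis using assms that by (simp add: field_simps)
  qed
  have "ennreal (\<bar>w \<bullet> (v /\<^sub>R ?K)\<bar> powr p) \<le> abs_moment M p w" for w
  proof (cases "abs_moment M p w")
    case (real a)
    define m where "m = a powr (1 / p)"
    have ma: "m powr p = a" "0 \<le> m" using real assms by (auto simp: m_def powr_powr)
    have "\<bar>w \<bullet> v\<bar> / ?K \<le> m"
    proof (rule dense_ge)
      fix m' assume m': "m < m'"
      have "m powr p \<le> m' powr p" using ma m' assms by (intro powr_mono2) auto
      then have mom: "abs_moment M p w \<le> ennreal (m' powr p)" using real ma by (simp add: ennreal_leI)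
      moreover have "abs_moment M p (- w) = abs_moment M p w" by (simp add: abs_moment_def)
      ultimately have "w \<bullet> v \<le> ?K * m'" "- w \<bullet> v \<le> ?K * m'"
        using bound[of m' w] bound[of m' "- w"] m' ma by auto
      then show "\<bar>w \<bullet> v\<bar> / ?K \<le> m'" using K by (simp add: divide_le_eq mult.commute abs_le_iff)
    qed
    moreover have "\<bar>w \<bullet> (v /\<^sub>R ?K)\<bar> = \<bar>w \<bullet> v\<bar> / ?K"
      unfolding divide_inverse by (subst abs_of_pos[OF positive_imp_inverse_positive[OF K], symmetric])
        (simp only: inner_scaleR_right abs_mult abs_abs mult.commute)
    ultimately have "\<bar>w \<bullet> (v /\<^sub>R ?K)\<bar> \<le> m" by simp
    then have "\<bar>w \<bullet> (v /\<^sub>R ?K)\<bar> powr p \<le> m powr p" using assms by (intro powr_mono2) auto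
    then show ?thesis using real ma by (simp add: ennreal_leI)
  qed simp
  then show ?thesis by (simp add: Zp_body_def)
qed

lemma Zp_body_symmetric: "z \<in> Zp_body p M \<Longrightarrow> - z \<in> Zp_body p M"
  by (simp add: Zp_body_def)

text \<open>
Regularity with \<open>q = 2\<close> and isotropy bound the \<open>p\<close>-th norm of \<open>\<lambda>y. x \<bullet> y\<close> by a multiple of
\<open>norm x\<close>; testing the definition of the body at \<open>v = x\<close> then bounds \<open>norm x\<close>.
\<close>
lemma compact_Zp_body:
  assumes reg: "regular_measure \<alpha> M" and "1 \<le> \<alpha>" "isotropic M" "2 \<le> p"
  shows "compact (Zp_body p M)"
proof -
  have mom: "abs_moment M p u \<le> ennreal ((\<alpha> * (p / 2) * norm u) powr p)" if "u \<noteq> 0" for u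
    using assms that by (intro abs_moment_le_of_regular[OF reg])
      (auto simp: abs_moment_2 powr_realpow'[of _ 2, simplified])
  have "norm x \<le> \<alpha> * (p / 2)" if x: "x \<in> Zp_body p M" for x
  proof (cases "x = 0")
    case False
    have "ennreal (\<bar>x \<bullet> x\<bar> powr p) \<le> ennreal ((\<alpha> * (p / 2) * norm x) powr p)"
      using x mom[OF False] unfolding Zp_body_def by (blast intro: order_trans)
    then have "\<bar>x \<bullet> x\<bar> powr p \<le> (\<alpha> * (p / 2) * norm x) powr p" by (simp add: ennreal_le_iff)
    then have "\<bar>x \<bullet> x\<bar> \<le> \<alpha> * (p / 2) * norm x"
      using powr_less_mono2[of p "\<alpha> * (p / 2) * norm x" "\<bar>x \<bullet> x\<bar>"] assms by force
    then have "norm x * norm x \<le> \<alpha> * (p / 2) * norm x"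
      by (simp add: power2_norm_eq_inner[symmetric] power2_eq_square)
    then show ?thesis using False by simp
  qed (use assms in simp)
  then have "bounded (Zp_body p M)" unfolding bounded_iff by blast
  moreover have "closed {x. ennreal (\<bar>v \<bullet> x\<bar> powr p) \<le> abs_moment M p v}" for v
    using assms by (intro closed_Collect_le continuous_on_const continuous_on_ennreal continuous_on_powr'
      continuous_intros) auto
  then have "closed (Zp_body p M)"
    unfolding Zp_body_def by (rule closed_Collect_all)
  ultimately show ?thesis by (simp add: compact_eq_bounded_closed)
qed

end

section \<open>Enlargement inequalities\<close>

text \<open>
A Minkowski sum of Borel sets need not be Borel, so the inequality is required of every Borel set
that contains it.
\<close>
definition enlarges :: "'a::euclidean_space measure \<Rightarrow> 'a set \<Rightarrow> real \<Rightarrow> bool" where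
  "enlarges M K t \<longleftrightarrow> (\<forall>A\<in>sets borel. \<forall>H\<in>sets borel.
     {a + z |a z. a \<in> A \<and> z \<in> K} \<subseteq> H \<longrightarrow> 1 / 2 \<le> measure M A \<longrightarrow>
     1 - measure M H \<le> exp (- t) * (1 - measure M A))"

lemma enlargesD:
  assumes "enlarges M K t" "A \<in> sets borel" "H \<in> sets borel"
    and "{a + z |a z. a \<in> A \<and> z \<in> K} \<subseteq> H" "1 / 2 \<le> measure M A"
  shows "1 - measure M H \<le> exp (- t) * (1 - measure M A)"
  using assms by (auto simp: enlarges_def)

context borel_prob_space
begin

lemma space_M: "space M = UNIV"
  using sets_eq_imp_space_eq[OF sets_M] by simp

lemma completed_measure_le:
  assumes "S \<subseteq> H" "H \<in> sets borel"
  shows "completed_measure M S \<le> prob H"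
proof -
  have "outer_measure_of M S \<le> emeasure M H"
    using outer_measure_of_mono[OF assms(1), of M] assms(2) sets_M by simp
  then show ?thesis
    unfolding completed_measure_def measure_def by (intro enn2real_mono) (auto simp: less_top[symmetric])
qed

lemma completed_measure_attained:
  obtains H where "H \<in> sets borel" "S \<subseteq> H" "completed_measure M S = prob H"
  using outer_measure_of_attain[of S M] space_M sets_M
  by (auto simp: completed_measure_def measure_def)

lemma prob_gt_eq: "f \<in> borel_measurable borel \<Longrightarrow> prob {x. (s::real) < f x} = 1 - prob {x. f x \<le> s}"
  using prob_compl[of "{x. f x \<le> s}"] space_M sets_M
  by (auto simp: Compl_eq_Diff_UNIV[symmetric] Collect_neg_eq[symmetric] not_le)

lemma CI_enlarges:
  assumes "CI \<beta> M" "2 \<le> p"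
  shows "enlarges M ((*\<^sub>R) \<beta> ` Zp_body p M) p"
  unfolding enlarges_def
proof (intro ballI impI)
  fix A H assume AH: "A \<in> sets borel" "H \<in> sets borel" "{a + z |a z. a \<in> A \<and> z \<in> (*\<^sub>R) \<beta> ` Zp_body p M} \<subseteq> H"
    "1 / 2 \<le> prob A"
  have "completed_measure M {a + \<beta> *\<^sub>R z |a z. a \<in> A \<and> z \<in> Zp_body p M} \<le> prob H"
    using AH by (intro completed_measure_le) auto
  moreover have "1 - completed_measure M {a + \<beta> *\<^sub>R z |a z. a \<in> A \<and> z \<in> Zp_body p M} \<le> exp (- p) * (1 - prob A)"
    using assms AH by (auto simp: CI_def)
  ultimately show "1 - prob H \<le> exp (- p) * (1 - prob A)" by linarith
qed

text \<open>
For a symmetric \<open>K\<close> the set \<open>- H + K\<close> misses \<open>A\<close>. If \<open>H\<close> has measure less than \<open>1/2\<close>, the enlargement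
inequality for \<open>- H\<close> therefore says that \<open>A\<close> is exponentially smaller than \<open>H\<close>.
\<close>
lemma enlarges_dual:
  assumes K: "enlarges M K t" "\<And>z. z \<in> K \<Longrightarrow> - z \<in> K"
    and AH: "A \<in> sets borel" "H \<in> sets borel" "{a + z |a z. a \<in> A \<and> z \<in> K} \<subseteq> H"
  shows "min (1 / 2) (exp t * prob A) \<le> prob H"
proof (cases "1 / 2 \<le> prob H")
  case False
  have compl: "prob (- B) = 1 - prob B" if "B \<in> sets borel" for B
    using prob_compl[of B] that space_M sets_M by (simp add: Compl_eq_Diff_UNIV)
  have "{a + z |a z. a \<in> - H \<and> z \<in> K} \<subseteq> - A"
  proof clarify
    fix b z assume "b \<notin> H" "z \<in> K" "b + z \<in> A"
    moreover have "(b + z) + - z \<in> H"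
      using AH(3) K(2)[OF \<open>z \<in> K\<close>] \<open>b + z \<in> A\<close> by blast
    ultimately show False by simp
  qed
  moreover have "1 / 2 \<le> prob (- H)" using False AH by (simp add: compl)
  moreover have "- H \<in> sets borel" "- A \<in> sets borel" using AH by auto
  ultimately have "1 - prob (- A) \<le> exp (- t) * (1 - prob (- H))"
    using K(1) unfolding enlarges_def by blast
  then have "exp t * prob A \<le> prob H"
    using AH by (simp add: compl exp_minus field_simps)
  then show ?thesis by simp
qed simp

end

section \<open>Integrating the inequality of Cheeger\<close>

text \<open>
For every rate \<open>c < \<kappa>\<close> the bound propagates: it survives limits from the left since \<open>F\<close> is
monotone, and the lower derivative extends it to the right of any point where it holds.
\<close>
lemma exp_decay_of_lower_derivative:
  fixes F :: "real \<Rightarrow> real"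
  assumes mono: "\<And>r s. 0 \<le> r \<Longrightarrow> r \<le> s \<Longrightarrow> F r \<le> F s" and F1: "\<And>r. F r \<le> 1"
    and deriv: "\<And>r. 0 \<le> r \<Longrightarrow>
      ereal (\<kappa> * (1 - F r)) \<le> Liminf (at_right 0) (\<lambda>h. ereal ((F (r + h) - F r) / h))"
    and "0 < \<kappa>" "0 \<le> r"
  shows "1 - F r \<le> exp (- \<kappa> * r) * (1 - F 0)"
proof -
  have decay: "1 - F r \<le> exp (- c * r) * (1 - F 0)" if c: "0 < c" "c < \<kappa>" and "0 \<le> r" for c r
  proof (rule ccontr)
    assume r: "\<not> 1 - F r \<le> exp (- c * r) * (1 - F 0)"
    define B where "B = {r. 0 \<le> r \<and> \<not> 1 - F r \<le> exp (- c * r) * (1 - F 0)}"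
    define r0 where "r0 = Inf B"
    have B_ne: "B \<noteq> {}" and B_bdd: "bdd_below B"
      using r \<open>0 \<le> r\<close> by (auto simp: B_def intro: bdd_belowI[of _ 0])
    have r0: "0 \<le> r0" unfolding r0_def using B_ne by (intro cInf_greatest) (auto simp: B_def)
    have before: "1 - F s \<le> exp (- c * s) * (1 - F 0)" if "0 \<le> s" "s < r0" for s
      using that cInf_lower[OF _ B_bdd, of s] by (auto simp: r0_def B_def)
    have at: "1 - F r0 \<le> exp (- c * r0) * (1 - F 0)"
    proof (cases "r0 = 0")
      case False
      have "((\<lambda>s. exp (- c * s) * (1 - F 0)) \<longlongrightarrow> exp (- c * r0) * (1 - F 0)) (at_left r0)"
        by (intro tendsto_intros)
      moreover have "\<forall>\<^sub>F s in at_left r0. 1 - F r0 \<le> exp (- c * s) * (1 - F 0)"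
      proof -
        have "0 < r0" using r0 False by simp
        from eventually_at_left_real[OF this] show ?thesis
        proof eventually_elim
          case (elim s)
          then show ?case using before[of s] mono[of s r0] by simp
        qed
      qed
      ultimately show ?thesis by (rule tendsto_lowerbound) simp
    qed simp
    obtain d where d: "0 < d" "\<And>h. 0 < h \<Longrightarrow> h < d \<Longrightarrow> 1 - F (r0 + h) \<le> exp (- c * (r0 + h)) * (1 - F 0)"
    proof (cases "F r0 = 1")
      case True
      have "F (r0 + h) = 1" if "0 < h" for h
        using mono[of r0 "r0 + h"] F1[of "r0 + h"] r0 that True by simp
      moreover have "0 \<le> exp (- c * x) * (1 - F 0)" for x using F1[of 0] by simp
      ultimately show thesis by (intro that[of 1]) auto
    next
      case False
      then have pos: "0 < 1 - F r0" using F1[of r0] by simp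
      then have "ereal (c * (1 - F r0)) < ereal (\<kappa> * (1 - F r0))" using c by simp
      also note deriv[OF r0]
      finally have "\<forall>\<^sub>F h in at_right 0. ereal (c * (1 - F r0)) < ereal ((F (r0 + h) - F r0) / h)"
        by (rule less_LiminfD)
      then obtain d where d: "0 < d" "\<And>h. 0 < h \<Longrightarrow> h < d \<Longrightarrow> c * (1 - F r0) < (F (r0 + h) - F r0) / h"
        unfolding eventually_at_right_field by auto
      have "1 - F (r0 + h) \<le> exp (- c * (r0 + h)) * (1 - F 0)" if h: "0 < h" "h < d" for h
      proof -
        have "c * h * (1 - F r0) \<le> F (r0 + h) - F r0"
          using d(2)[OF h] h by (simp add: field_simps)
        then have "1 - F (r0 + h) \<le> (1 + - c * h) * (1 - F r0)" by (simp add: algebra_simps)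
        also have "\<dots> \<le> exp (- c * h) * (1 - F r0)"
          using pos exp_ge_add_one_self[of "- c * h"] by (intro mult_right_mono) auto
        also have "\<dots> \<le> exp (- c * h) * (exp (- c * r0) * (1 - F 0))"
          using at by (intro mult_left_mono) auto
        also have "\<dots> = exp (- c * (r0 + h)) * (1 - F 0)"
          by (simp add: distrib_left flip: exp_add mult.assoc)
        finally show ?thesis .
      qed
      with d(1) show thesis by (rule that)
    qed
    have "r0 + d \<le> s" if "s \<in> B" for s
      using that before[of s] at d(2)[of "s - r0"] by (force simp: B_def)
    then have "r0 + d \<le> r0" unfolding r0_def using B_ne by (intro cInf_greatest) auto
    with d(1) show False by simp
  qed
  have "((\<lambda>c. exp (- c * r) * (1 - F 0)) \<longlongrightarrow> exp (- \<kappa> * r) * (1 - F 0)) (at_left \<kappa>)"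
    by (intro tendsto_intros)
  moreover have "\<forall>\<^sub>F c in at_left \<kappa>. 1 - F r \<le> exp (- c * r) * (1 - F 0)"
    using eventually_at_left_real[OF \<open>0 < \<kappa>\<close>] decay \<open>0 \<le> r\<close> by (auto elim!: eventually_mono)
  ultimately show ?thesis by (rule tendsto_lowerbound) simp
qed

context borel_prob_space
begin

text \<open>
The closed neighbourhoods of \<open>A\<close> are Borel, and adding a ball of radius \<open>h\<close> to the one of radius
\<open>r\<close> stays within the one of radius \<open>r + h\<close>. Hence the measure of the neighbourhood, as a function
of its radius, has a lower derivative that is bounded below by the boundary measure.
\<close>
lemma cheeger_enlargement:
  assumes "cheeger (1 / \<gamma>) M" "0 < \<gamma>" "A \<in> sets borel" "1 / 2 \<le> prob A" "0 \<le> r"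
  shows "1 - prob {x. infdist x A \<le> r} \<le> exp (- r / \<gamma>) * (1 - prob A)"
proof -
  define F where "F r = prob {x. infdist x A \<le> r}" for r
  have meas: "{x. infdist x A \<le> r} \<in> sets borel" for r
    by (intro borel_closed closed_Collect_le continuous_intros)
  have mono: "F r \<le> F s" if "r \<le> s" for r s
    unfolding F_def using that meas sets_M by (intro finite_measure_mono) auto
  have FA: "prob A \<le> F 0"
    unfolding F_def using meas sets_M by (intro finite_measure_mono) auto
  have "1 - F r \<le> exp (- (1 / \<gamma>) * r) * (1 - F 0)"
  proof (rule exp_decay_of_lower_derivative)
    fix r :: real assume r: "0 \<le> r"
    let ?A = "{x. infdist x A \<le> r}"
    have "1 / 2 \<le> F r" using FA mono[OF r] assms by simp
    then have "ereal (1 / \<gamma> * (1 - F r)) = ereal (1 / \<gamma> * min (measure M ?A) (1 - measure M ?A))"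
      by (simp add: F_def)
    also have "\<dots> \<le> boundary_measure M ?A"
      using assms meas by (auto simp: cheeger_def)
    also have "\<dots> \<le> Liminf (at_right 0) (\<lambda>h. ereal ((F (r + h) - F r) / h))"
      unfolding boundary_measure_def
    proof (intro Liminf_mono)
      show "\<forall>\<^sub>F h in at_right 0. ereal ((completed_measure M {a + h *\<^sub>R b |a b. a \<in> ?A \<and> b \<in> cball 0 1} - prob ?A) / h)
          \<le> ereal ((F (r + h) - F r) / h)"
        using eventually_at_right_less
      proof eventually_elim
        case (elim h)
        have "completed_measure M {a + h *\<^sub>R b |a b. a \<in> ?A \<and> b \<in> cball 0 1} \<le> F (r + h)"
          unfolding F_def
        proof (intro completed_measure_le meas subsetI)
          fix x assume "x \<in> {a + h *\<^sub>R b |a b. a \<in> ?A \<and> b \<in> cball 0 1}"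
          then obtain a b where x: "x = a + h *\<^sub>R b" "infdist a A \<le> r" "norm b \<le> 1" by auto
          have "infdist x A \<le> infdist a A + dist x a" by (rule infdist_triangle)
          also have "dist x a \<le> h" using x elim by (simp add: dist_norm mult_left_le)
          finally show "x \<in> {x. infdist x A \<le> r + h}" using x by simp
        qed
        then show ?case using elim by (simp add: F_def divide_right_mono)
      qed
    qed
    finally show "ereal (1 / \<gamma> * (1 - F r)) \<le> Liminf (at_right 0) (\<lambda>h. ereal ((F (r + h) - F r) / h))" .
  qed (use assms mono in \<open>auto simp: F_def\<close>)
  also have "\<dots> \<le> exp (- (1 / \<gamma>) * r) * (1 - prob A)"
    using FA by (intro mult_left_mono) auto
  finally show ?thesis by (simp add: F_def)
qed

text \<open>
The factor \<open>2\<close> in the radius absorbs that the distance to \<open>A\<close> need not be attained.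
\<close>
lemma cheeger_enlarges:
  assumes "cheeger (1 / \<gamma>) M" "0 < \<gamma>" "0 < t"
  shows "enlarges M (cball 0 (2 * \<gamma> * t)) t"
  unfolding enlarges_def
proof (intro ballI impI)
  fix A H :: "'a set" assume AH: "A \<in> sets borel" "H \<in> sets borel"
    and sub: "{a + z |a z. a \<in> A \<and> z \<in> cball 0 (2 * \<gamma> * t)} \<subseteq> H" and half: "1 / 2 \<le> prob A"
  then have "A \<noteq> {}" by auto
  have "{x. infdist x A \<le> \<gamma> * t} \<subseteq> H"
  proof clarify
    fix x assume "infdist x A \<le> \<gamma> * t"
    moreover have "0 < \<gamma> * t" using assms by simp
    ultimately have "infdist x A < 2 * \<gamma> * t" by linarith
    then obtain a where a: "a \<in> A" "dist x a < 2 * \<gamma> * t"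
      using \<open>A \<noteq> {}\<close> cInf_lessD[of "dist x ` A"] by (auto simp: infdist_def)
    have "x - a \<in> cball 0 (2 * \<gamma> * t)" using a by (simp add: dist_norm norm_minus_commute)
    then have "a + (x - a) \<in> H" using a sub by blast
    then show "x \<in> H" by simp
  qed
  then have "prob {x. infdist x A \<le> \<gamma> * t} \<le> prob H"
    using AH sets_M by (intro finite_measure_mono) auto
  moreover have "1 - prob {x. infdist x A \<le> \<gamma> * t} \<le> exp (- t) * (1 - prob A)"
    using cheeger_enlargement[OF assms(1,2) AH(1) half, of "\<gamma> * t"] assms by simp
  ultimately show "1 - prob H \<le> exp (- t) * (1 - prob A)" by linarith
qed

end

section \<open>From property \<open>(\<tau>)\<close> to enlargement inequalities and back\<close>

lemma exp_ereal_simps [simp]: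
  "exp_ereal (ereal r) = ennreal (exp r)" "exp_ereal \<infinity> = top" "exp_ereal (- \<infinity>) = 0"
  by (simp_all add: exp_ereal_def)

lemma exp_ereal_mono: "x \<le> y \<Longrightarrow> exp_ereal x \<le> exp_ereal y"
  by (cases x; cases y) (auto intro: ennreal_leI)

text \<open>
The hypothesis can be solved for \<open>1 - h\<close>:
\<open>(1 - h) * (1 + (exp t - 1) * a) \<le> 1 - a\<close>, where the factor is at least
\<open>(exp t + 1) / 2 \<ge> exp (t / 2)\<close>.
\<close>
lemma tau_enlargement_arith:
  fixes a h t :: real
  assumes "0 < t" "1 / 2 \<le> a" "h \<le> 1"
    and le: "(h + exp t * (1 - h)) * (a + exp (- t) * (1 - a)) \<le> 1"
  shows "1 - h \<le> exp (- (t / 2)) * (1 - a)"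
proof -
  define E where "E = exp (t / 2)"
  have "1 < E" using assms by (simp add: E_def)
  moreover have t: "exp t = E * E" by (simp add: E_def flip: exp_add)
  moreover have "exp (- t) = 1 / (E * E)" by (simp add: exp_minus t inverse_eq_divide)
  moreover have "exp (- (t / 2)) = 1 / E" by (simp add: exp_minus E_def inverse_eq_divide)
  ultimately have E: "1 < E" "exp t = E * E" "exp (- t) = 1 / (E * E)" "exp (- (t / 2)) = 1 / E"
    by auto
  have EE: "1 < E * E" using E by (simp add: less_1_mult)
  have "(h + E * E * (1 - h)) * (a * (E * E) + (1 - a)) \<le> E * E"
    using le E EE by (simp add: field_simps)
  then have "(E * E - 1) * ((1 - h) * (1 + (E * E - 1) * a)) \<le> (E * E - 1) * (1 - a)"
    by (simp add: algebra_simps)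
  then have "(1 - h) * (1 + (E * E - 1) * a) \<le> 1 - a" using EE by simp
  moreover have "E \<le> 1 + (E * E - 1) * a"
  proof -
    have "(E * E - 1) * (1 / 2) \<le> (E * E - 1) * a" using EE assms by (intro mult_left_mono) auto
    moreover have "0 \<le> (E - 1) * (E - 1)" by simp
    then have "E \<le> 1 + (E * E - 1) * (1 / 2)" by (simp add: field_simps)
    ultimately show ?thesis by linarith
  qed
  then have "(1 - h) * E \<le> (1 - h) * (1 + (E * E - 1) * a)" using assms by (intro mult_left_mono) auto
  ultimately have "(1 - h) * E \<le> 1 - a" by linarith
  then show ?thesis unfolding E(4) using E(1) by (simp add: field_simps)
qed

context borel_prob_space
begin

text \<open>
The test function is \<open>0\<close> on \<open>A\<close> and \<open>2 * t\<close> off \<open>A\<close>. Its infimum convolution with \<open>\<phi>\<close> is at least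
\<open>2 * t\<close> outside \<open>A + {\<phi> \<le> 2 * t}\<close>.
\<close>
lemma property_tau_enlarges:
  assumes tau: "property_tau M \<phi>" and "0 < t"
  shows "enlarges M {z. \<phi> z \<le> ereal (2 * t)} t"
  unfolding enlarges_def
proof (intro ballI impI)
  fix A H :: "'a set"
  assume A: "A \<in> sets borel" and H: "H \<in> sets borel"
    and sub: "{a + z |a z. a \<in> A \<and> z \<in> {z. \<phi> z \<le> ereal (2 * t)}} \<subseteq> H" and half: "1 / 2 \<le> prob A"
  define f where "f = (\<lambda>x. if x \<in> A then 0 else 2 * t)"
  have [measurable]: "A \<in> sets M" "H \<in> sets M" using A H sets_M by auto
  have f: "f \<in> borel_measurable borel"
    unfolding f_def using A by (intro measurable_If_set) auto
  have "bounded (range f)" by (rule boundedI[of _ "2 * t"]) (use \<open>0 < t\<close> in \<open>auto simp: f_def\<close>)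
  with tau f have le: "(\<integral>\<^sup>+ x. exp_ereal (inf_conv (\<lambda>y. ereal (f y)) \<phi> x) \<partial>M) * (\<integral>\<^sup>+ x. ennreal (exp (- f x)) \<partial>M) \<le> 1"
    unfolding property_tau_def by blast
  have phi: "0 \<le> \<phi> z" for z using tau by (simp add: property_tau_def)
  have two: "(\<integral>\<^sup>+ x. ennreal (if x \<in> B then u else v) \<partial>M) = ennreal (u * prob B + v * (1 - prob B))"
    if [measurable]: "B \<in> sets M" and "0 \<le> u" "0 \<le> v" for B u v
  proof -
    have "(\<integral>\<^sup>+ x. ennreal (if x \<in> B then u else v) \<partial>M)
        = (\<integral>\<^sup>+ x. ennreal u * indicator B x + ennreal v * indicator (space M - B) x \<partial>M)"
      by (intro nn_integral_cong) (auto split: split_indicator)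
    also have "\<dots> = ennreal u * emeasure M B + ennreal v * emeasure M (space M - B)"
      by (subst nn_integral_add) (auto simp: nn_integral_cmult_indicator)
    also have "\<dots> = ennreal (u * prob B + v * (1 - prob B))"
      using that by (simp add: emeasure_eq_measure prob_compl ennreal_mult)
    finally show ?thesis .
  qed
  have "(\<integral>\<^sup>+ x. ennreal (if x \<in> H then 1 else exp (2 * t)) \<partial>M)
      \<le> (\<integral>\<^sup>+ x. exp_ereal (inf_conv (\<lambda>y. ereal (f y)) \<phi> x) \<partial>M)"
  proof (intro nn_integral_mono)
    fix x
    have "ereal (if x \<in> H then 0 else 2 * t) \<le> inf_conv (\<lambda>y. ereal (f y)) \<phi> x"
      unfolding inf_conv_def
    proof (intro INF_greatest)
      fix y
      show "ereal (if x \<in> H then 0 else 2 * t) \<le> ereal (f (x - y)) + \<phi> y"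
      proof (cases "x \<notin> H \<and> x - y \<in> A")
        case True
        then have "\<not> \<phi> y \<le> ereal (2 * t)" using sub by force
        then show ?thesis using True by (simp add: f_def)
      next
        case False
        then have "ereal (if x \<in> H then 0 else 2 * t) + 0 \<le> ereal (f (x - y)) + \<phi> y"
          using phi \<open>0 < t\<close> by (intro add_mono) (auto simp: f_def)
        then show ?thesis by simp
      qed
    qed
    from exp_ereal_mono[OF this]
    show "ennreal (if x \<in> H then 1 else exp (2 * t)) \<le> exp_ereal (inf_conv (\<lambda>y. ereal (f y)) \<phi> x)"
      by (simp split: if_splits)
  qed
  then have I: "ennreal (prob H + exp (2 * t) * (1 - prob H)) \<le> (\<integral>\<^sup>+ x. exp_ereal (inf_conv (\<lambda>y. ereal (f y)) \<phi> x) \<partial>M)"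
    by (subst (asm) two) auto
  have "(\<integral>\<^sup>+ x. ennreal (exp (- f x)) \<partial>M) = (\<integral>\<^sup>+ x. ennreal (if x \<in> A then 1 else exp (- (2 * t))) \<partial>M)"
    by (intro nn_integral_cong) (simp add: f_def)
  also have "\<dots> = ennreal (prob A + exp (- (2 * t)) * (1 - prob A))"
    by (subst two) auto
  finally have J: "(\<integral>\<^sup>+ x. ennreal (exp (- f x)) \<partial>M) = ennreal (prob A + exp (- (2 * t)) * (1 - prob A))" .
  have "ennreal ((prob H + exp (2 * t) * (1 - prob H)) * (prob A + exp (- (2 * t)) * (1 - prob A)))
      = ennreal (prob H + exp (2 * t) * (1 - prob H)) * ennreal (prob A + exp (- (2 * t)) * (1 - prob A))"
    by (intro ennreal_mult) auto
  also have "\<dots> \<le> 1"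
    using le mult_right_mono[OF I] unfolding J by (meson order_trans zero_le)
  finally have "(prob H + exp (2 * t) * (1 - prob H)) * (prob A + exp (- (2 * t)) * (1 - prob A)) \<le> 1"
    by (simp only: ennreal_le_1)
  from tau_enlargement_arith[OF _ half prob_le_1 this] \<open>0 < t\<close>
  show "1 - prob H \<le> exp (- t) * (1 - prob A)" by simp
qed

text \<open>
The nonnegative integral of the possibly nonmeasurable infimum convolution is a supremum over simple
functions below it, so it suffices to treat one such function \<open>g = exp q\<close>. Since
\<open>q (a + z) \<le> f a + \<phi> z\<close>, each sublevel set of \<open>q\<close> is a Borel set that contains an enlarged sublevel set
of \<open>f\<close>, and the comparison of distribution functions applies. Where two enlargements follow one
another, the first is applied to a compact subset, so that the enlarged set is again Borel; this is
what compactness of \<open>K t\<close> is for.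
\<close>
lemma property_tau_of_enlargements:
  assumes K: "\<And>t. 0 < t \<Longrightarrow> compact (K t)" "\<And>t z. 0 < t \<Longrightarrow> z \<in> K t \<Longrightarrow> - z \<in> K t"
      "\<And>t. 0 < t \<Longrightarrow> enlarges M (K t) t"
    and \<phi>: "\<phi> \<in> borel_measurable borel" "\<And>z. 0 \<le> \<phi> z" "\<phi> 0 \<le> 0"
    and cost: "\<And>t z. 0 < t \<Longrightarrow> z \<in> K t \<Longrightarrow> \<phi> z \<le> ereal (logcosh_cost t)"
    and cost2: "\<And>t t' z z'. 0 < t \<Longrightarrow> 0 < t' \<Longrightarrow> z \<in> K t \<Longrightarrow> z' \<in> K t' \<Longrightarrow>
      \<phi> (z + z') \<le> ereal (logcosh_cost t + logcosh_cost t')"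
  shows "property_tau M \<phi>"
  unfolding property_tau_def
proof (intro conjI allI impI)
  fix f :: "'a \<Rightarrow> real"
  assume "f \<in> borel_measurable borel \<and> bounded (range f)"
  then have f[measurable]: "f \<in> borel_measurable borel" and "bounded (range f)" by auto
  then obtain B where B: "\<And>x. \<bar>f x\<bar> \<le> B" by (auto simp: bounded_iff)
  define Q where "Q = inf_conv (\<lambda>y. ereal (f y)) \<phi>"
  have Q_le: "Q (a + z) \<le> ereal (f a + c)" if "\<phi> z \<le> ereal c" for a z c
  proof -
    have "Q (a + z) \<le> ereal (f (a + z - z)) + \<phi> z"
      unfolding Q_def inf_conv_def by (rule INF_lower) simp
    also have "\<dots> \<le> ereal (f a) + ereal c" using that by (intro add_mono) auto
    finally show ?thesis by simp
  qed
  have simple: "(\<integral>\<^sup>+x. g x \<partial>M) * (\<integral>\<^sup>+x. ennreal (exp (- f x)) \<partial>M) \<le> 1"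
    if g: "simple_function M g" "g \<le> (\<lambda>x. exp_ereal (Q x))" for g
  proof -
    have [measurable]: "g \<in> borel_measurable M" using g(1) by (rule borel_measurable_simple_function)
    have [measurable_cong]: "sets M = sets borel" by (rule sets_M)
    have g_le: "g (a + z) \<le> ennreal (exp (f a + c))" if "\<phi> z \<le> ereal c" for a z c
      using g(2) exp_ereal_mono[OF Q_le[OF that, of a]] by (auto simp: le_fun_def intro: order_trans)
    \<comment> \<open>The lower bound \<open>exp (- B)\<close> makes the logarithm bounded; the infimum convolution respects it.\<close>
    define q where "q = (\<lambda>x. ln (max (enn2real (g x)) (exp (- B))))"
    have pos: "0 < max (enn2real (g x)) (exp (- B))" for x by (simp add: less_max_iff_disj)
    have q_le: "q (a + z) \<le> f a + c" if "\<phi> z \<le> ereal c" "0 \<le> c" for a z c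
    proof -
      have "enn2real (g (a + z)) \<le> exp (f a + c)"
        using g_le[OF that(1), of a] by (intro enn2real_leI) auto
      moreover have "exp (- B) \<le> exp (f a + c)" using B[of a] that by simp
      ultimately have "max (enn2real (g (a + z))) (exp (- B)) \<le> exp (f a + c)" by simp
      then have "q (a + z) \<le> ln (exp (f a + c))"
        unfolding q_def using pos[of "a + z"] by (subst ln_le_cancel_iff) auto
      then show ?thesis by simp
    qed
    have q_le_f: "q x \<le> f x" for x using q_le[of 0 0 x] \<phi>(3) by (simp add: zero_ereal_def)
    have q_ge: "- B \<le> q x" for x
    proof -
      have "ln (exp (- B)) \<le> q x" unfolding q_def using pos by (subst ln_le_cancel_iff) auto
      then show ?thesis by simp
    qed
    have [measurable]: "q \<in> borel_measurable M" unfolding q_def by measurable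
    then have qb [measurable]: "q \<in> borel_measurable borel" by (simp cong: measurable_cong_sets add: sets_M)
    have "(\<integral>\<^sup>+x. g x \<partial>M) \<le> (\<integral>\<^sup>+x. ennreal (exp (q x)) \<partial>M)"
    proof (intro nn_integral_mono)
      fix x
      have "g x < top" using g_le[of 0 0 x] \<phi>(3) by (auto simp: zero_ereal_def less_top intro: le_less_trans)
      then have "g x = ennreal (enn2real (g x))" by simp
      also have "\<dots> \<le> ennreal (max (enn2real (g x)) (exp (- B)))" by (intro ennreal_leI) simp
      also have "\<dots> = ennreal (exp (q x))" using pos[of x] by (simp add: q_def)
      finally show "g x \<le> ennreal (exp (q x))" .
    qed
    then have "(\<integral>\<^sup>+x. g x \<partial>M) * (\<integral>\<^sup>+x. ennreal (exp (- f x)) \<partial>M)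
        \<le> (\<integral>\<^sup>+x. ennreal (exp (q x)) \<partial>M) * (\<integral>\<^sup>+x. ennreal (exp (- f x)) \<partial>M)"
      by (rule mult_right_mono) simp
    also have "\<dots> \<le> 1"
    proof (rule exp_product_le_1_of_levels[where B = B], simp_all only: space_M UNIV_I simp_thms)
      have level: "{x. h x \<le> s} \<in> sets borel" if "h \<in> borel_measurable borel" for h :: "'a \<Rightarrow> real" and s
        using that by measurable
      have sub: "{a + z |a z. a \<in> {x. f x \<le> s} \<and> z \<in> K t} \<subseteq> {x. q x \<le> s + logcosh_cost t}"
        if "0 < t" for s t
      proof clarify
        fix a z assume "f a \<le> s" "z \<in> K t"
        then show "q (a + z) \<le> s + logcosh_cost t"
          using q_le[OF cost[OF that \<open>z \<in> K t\<close>] logcosh_cost_nonneg, of a] by linarith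
      qed
      show "f \<in> borel_measurable M" by measurable
      show "q \<in> borel_measurable M" by measurable
      show "\<bar>f x\<bar> \<le> B" for x by (rule B)
      show "\<bar>q x\<bar> \<le> B" for x using q_ge[of x] q_le_f[of x] B[of x] by (simp add: abs_le_iff)
      show "min (1 / 2) (exp t * prob {x. f x \<le> s}) \<le> prob {x. q x \<le> s + logcosh_cost t}"
        if "0 < t" for s t
        using enlarges_dual[OF K(3)[OF that] K(2)[OF that] level[OF f] level[OF qb] sub[OF that]] .
      show "prob {x. s + logcosh_cost t < q x} \<le> exp (- t) * prob {x. s < f x}"
        if "0 < t" "1 / 2 \<le> prob {x. f x \<le> s}" for s t
        unfolding prob_gt_eq[OF f] prob_gt_eq[OF qb]
        by (rule enlargesD[OF K(3)[OF that(1)] level[OF f] level[OF qb] sub[OF that(1)] that(2)])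
      show "prob {x. s + logcosh_cost t + logcosh_cost t' < q x} \<le> exp (- t') / 2"
        if t: "0 < t" "0 < t'" and half: "1 / 2 < exp t * prob {x. f x \<le> s}" for s t t'
      proof -
        let ?A = "{x. f x \<le> s}" and ?H = "{x. q x \<le> s + logcosh_cost t + logcosh_cost t'}"
        have "ennreal (1 / (2 * exp t)) < emeasure M ?A"
          using half by (simp add: emeasure_eq_measure ennreal_less_iff field_simps)
        also have "emeasure M ?A = (SUP C \<in> {C. C \<subseteq> ?A \<and> compact C}. emeasure M C)"
          using level[OF f] by (intro inner_regular sets_M) (auto simp: emeasure_eq_measure)
        finally obtain C where C: "C \<subseteq> ?A" "compact C" "ennreal (1 / (2 * exp t)) < emeasure M C"
          by (auto simp: less_SUP_iff)
        then have C_half: "1 / 2 \<le> exp t * prob C"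
          by (simp add: emeasure_eq_measure ennreal_less_iff field_simps)
        let ?D = "{a + z |a z. a \<in> C \<and> z \<in> K t}"
        have "compact ?D" using compact_sums[OF C(2) K(1)[OF t(1)]] .
        then have D: "?D \<in> sets borel" by (intro borel_compact)
        have "C \<in> sets borel" using C(2) by (intro borel_compact)
        from enlarges_dual[OF K(3)[OF t(1)] K(2)[OF t(1)] this D order_refl] C_half
        have D_half: "1 / 2 \<le> prob ?D" by simp
        have "{a + z |a z. a \<in> ?D \<and> z \<in> K t'} \<subseteq> ?H"
        proof clarify
          fix a z z' assume "a \<in> C" "z \<in> K t" "z' \<in> K t'"
          then show "q (a + z + z') \<le> s + logcosh_cost t + logcosh_cost t'"
            using q_le[OF cost2[OF t \<open>z \<in> K t\<close> \<open>z' \<in> K t'\<close>], of a] C(1)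
              logcosh_cost_nonneg[of t] logcosh_cost_nonneg[of t'] by (auto simp: add.assoc)
        qed
        then have "1 - prob ?H \<le> exp (- t') * (1 - prob ?D)"
          by (rule enlargesD[OF K(3)[OF t(2)] D level[OF qb] _ D_half])
        also have "\<dots> \<le> exp (- t') * (1 / 2)" using D_half by (intro mult_left_mono) auto
        finally show ?thesis by (simp add: prob_gt_eq[OF qb])
      qed
    qed
    finally show ?thesis .
  qed
  have "(\<integral>\<^sup>+ x. exp_ereal (Q x) \<partial>M) * (\<integral>\<^sup>+x. ennreal (exp (- f x)) \<partial>M) \<le> 1"
    unfolding nn_integral_def[of M "\<lambda>x. exp_ereal (Q x)"] SUP_mult_right_ennreal
    using simple by (intro SUP_least) (auto simp flip: nn_integral_eq_simple_integral)
  then show "(\<integral>\<^sup>+ x. exp_ereal (inf_conv (\<lambda>y. ereal (f y)) \<phi> x) \<partial>M) * (\<integral>\<^sup>+x. ennreal (exp (- f x)) \<partial>M) \<le> 1"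
    by (simp add: Q_def)
qed (use \<phi> in auto)

end

section \<open>Equivalence of the two concentration properties\<close>

lemma ln_one_plus_ge:
  fixes w :: real
  assumes "0 \<le> w" shows "w / (1 + w) \<le> ln (1 + w)"
  using ln_le_minus_one[of "1 / (1 + w)"] assms by (simp add: ln_div field_simps)

lemma logcosh_cost_ge_quadratic:
  assumes "0 \<le> t" "t \<le> 3"
  shows "t\<^sup>2 / 27 \<le> logcosh_cost t"
proof -
  define s where "s = t / 3"
  define w where "w = s\<^sup>2 / 2"
  have s: "0 \<le> s" "s \<le> 1" using assms by (auto simp: s_def)
  then have "s\<^sup>2 \<le> 1" by (simp add: power_le_one)
  then have w: "0 \<le> w" "w \<le> 1 / 2" by (auto simp: w_def)
  have "t\<^sup>2 / 27 = w / (3 / 2)" by (simp add: w_def s_def power2_eq_square)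
  also have "\<dots> \<le> w / (1 + w)" using w by (intro divide_left_mono) auto
  also have "\<dots> \<le> ln (1 + w)" using w by (intro ln_one_plus_ge)
  also have "\<dots> \<le> ln (cosh s)"
  proof (rule ln_mono)
    show "1 + w \<le> cosh s"
      using two_plus_square_le_exp_plus_exp_minus[of s] by (simp add: w_def cosh_def)
  qed (use w in simp)
  finally show ?thesis by (simp add: logcosh_cost_def s_def)
qed

text \<open>
For \<open>t > 3\<close> this rests on \<open>cosh x \<ge> exp x / 2\<close> and \<open>ln 2 \<le> 25/36\<close>.
\<close>
lemma logcosh_cost_ge_linear:
  assumes "2 \<le> t"
  shows "2 * t / 27 \<le> logcosh_cost t"
proof (cases "t \<le> 3")
  case True
  have "2 * t / 27 \<le> t\<^sup>2 / 27"
    using assms by (simp add: power2_eq_square mult_right_mono)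
  also have "\<dots> \<le> logcosh_cost t" using True assms by (intro logcosh_cost_ge_quadratic) auto
  finally show ?thesis .
next
  case False
  have "exp (t / 3) / 2 \<le> cosh (t / 3)" by (simp add: cosh_def)
  then have "ln (exp (t / 3) / 2) \<le> ln (cosh (t / 3))" by (intro ln_mono) auto
  then have "t / 3 - ln 2 \<le> logcosh_cost t" by (simp add: ln_div logcosh_cost_def)
  with ln2_le_25_over_36 False show ?thesis by linarith
qed

context borel_prob_space
begin

text \<open>
Halving turns the level \<open>2 * p\<close> into \<open>p\<close>, so that \<open>{\<Lambda>* \<le> 2 * p}\<close> lies in
\<open>2 * (4 * exp 1 * \<alpha>)\<close> times \<open>Zp_body p M\<close>.
\<close>
lemma IC_imp_CI:
  assumes reg: "regular_measure \<alpha> M" "1 \<le> \<alpha>" and M: "symmetric_measure M" "isotropic M"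
    and "0 < \<beta>" "IC \<beta> M"
  shows "CI (8 * exp 1 * \<alpha> * \<beta>) M"
  unfolding CI_def
proof (intro allI impI ballI)
  fix p :: real and A assume p: "2 \<le> p" and A: "A \<in> sets borel" "1 / 2 \<le> prob A"
  let ?K = "8 * exp 1 * \<alpha> * \<beta>"
  let ?S = "{a + ?K *\<^sub>R z |a z. a \<in> A \<and> z \<in> Zp_body p M}"
  obtain H where H: "H \<in> sets borel" "?S \<subseteq> H" "completed_measure M ?S = prob H"
    by (rule completed_measure_attained)
  let ?B = "{z. cramer_transform M (z /\<^sub>R \<beta>) \<le> ereal (2 * p)}"
  have "enlarges M ?B p"
    using assms p unfolding IC_def by (intro property_tau_enlarges) auto
  moreover have "{a + z |a z. a \<in> A \<and> z \<in> ?B} \<subseteq> H"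
  proof clarify
    fix a z assume "a \<in> A" and z: "cramer_transform M (z /\<^sub>R \<beta>) \<le> ereal (2 * p)"
    have "cramer_transform M ((1 / 2) *\<^sub>R (z /\<^sub>R \<beta>)) \<le> ereal (1 / 2 * (2 * p))"
      by (rule cramer_transform_scale[OF M _ _ z]) auto
    then have "((1 / 2) *\<^sub>R (z /\<^sub>R \<beta>)) /\<^sub>R (4 * exp 1 * \<alpha>) \<in> Zp_body p M"
      using p by (intro cramer_sublevel_subset_Zp_body[OF reg]) auto
    moreover have "?K *\<^sub>R (((1 / 2) *\<^sub>R (z /\<^sub>R \<beta>)) /\<^sub>R (4 * exp 1 * \<alpha>)) = z"
    proof -
      have "?K * inverse (4 * exp 1 * \<alpha>) * (1 / 2) * inverse \<beta> = 1"
        using assms(2,5) by (simp add: field_simps)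
      then show ?thesis by (simp only: scaleR_scaleR mult.assoc[symmetric] scaleR_one)
    qed
    ultimately have "a + z \<in> ?S" using \<open>a \<in> A\<close> by force
    then show "a + z \<in> H" using H by auto
  qed
  ultimately have "1 - prob H \<le> exp (- p) * (1 - prob A)"
    using A H(1) enlargesD by blast
  then show "1 - completed_measure M ?S \<le> exp (- p) * (1 - prob A)" using H by simp
qed

text \<open>
Balls serve below \<open>t = 2\<close>, the least exponent that \<open>CI\<close> admits. The estimate \<open>double\<close> bounds the
transform at twice the required argument, so that by convexity it controls sums of two vectors,
which the passage to property \<open>(\<tau>)\<close> calls for.
\<close>
lemma CI_cheeger_imp_IC:
  assumes reg: "regular_measure \<alpha> M" "1 \<le> \<alpha>" and M: "symmetric_measure M" "isotropic M"
    and "0 < \<beta>" "0 < \<gamma>" and CI: "CI \<beta> M" and cheeger: "cheeger (1 / \<gamma>) M"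
  shows "IC (36 * max (6 * exp 1 * \<beta>) \<gamma>) M"
  unfolding IC_def
proof -
  define C where "C = 36 * max (6 * exp 1 * \<beta>) \<gamma>"
  have C: "0 < C" "36 * \<gamma> \<le> C" "36 * (6 * exp 1 * \<beta>) \<le> C"
    using \<open>0 < \<gamma>\<close> unfolding C_def by (auto simp only: mult_le_cancel_left_pos zero_less_mult_iff less_max_iff_disj max.cobounded1 max.cobounded2 zero_less_numeral)
  define K where "K t = (if t < 2 then cball 0 (2 * \<gamma> * t) else (*\<^sub>R) \<beta> ` Zp_body t M)" for t
  have double: "cramer_transform M (2 *\<^sub>R (z /\<^sub>R C)) \<le> ereal (2 * logcosh_cost t)"
    if t: "0 < t" and z: "z \<in> K t" for t z
  proof (cases "t < 2")
    case True
    then have "norm z \<le> 2 * \<gamma> * t" using z by (simp add: K_def)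
    also have "\<dots> = t * (36 * \<gamma>) / 18" by simp
    also have "\<dots> \<le> t * C / 18" using C t by (intro divide_right_mono mult_left_mono) auto
    finally have n: "norm (2 *\<^sub>R (z /\<^sub>R C)) \<le> t / 9" using C by (simp add: field_simps)
    then have "cramer_transform M (2 *\<^sub>R (z /\<^sub>R C)) \<le> ereal (3 / 2 * (norm (2 *\<^sub>R (z /\<^sub>R C)))\<^sup>2)"
      using True by (intro cramer_transform_le_quadratic[OF M]) linarith
    also have "\<dots> \<le> ereal (2 * logcosh_cost t)"
    proof -
      have "(norm (2 *\<^sub>R (z /\<^sub>R C)))\<^sup>2 \<le> (t / 9)\<^sup>2" using n by (intro power_mono) auto
      also have "(t / 9)\<^sup>2 = t\<^sup>2 / 81" by (simp add: power_divide)
      finally have "3 / 2 * (norm (2 *\<^sub>R (z /\<^sub>R C)))\<^sup>2 \<le> 2 * (t\<^sup>2 / 27)"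
        using zero_le_power2[of t] by linarith
      with logcosh_cost_ge_quadratic[of t] t True show ?thesis by simp
    qed
    finally show ?thesis .
  next
    case False
    then obtain \<zeta> where \<zeta>: "\<zeta> \<in> Zp_body t M" "z = \<beta> *\<^sub>R \<zeta>" using z by (auto simp: K_def)
    define l where "l = 2 * \<beta> / C"
    have "36 * (6 * 1 * \<beta>) \<le> 36 * (6 * exp 1 * \<beta>)"
      using \<open>0 < \<beta>\<close> by (intro mult_left_mono mult_right_mono) auto
    then have "216 * \<beta> \<le> C" using C by linarith
    then have l: "0 \<le> l" "l \<le> 1 / 108" using C \<open>0 < \<beta>\<close> by (auto simp: l_def field_simps)
    have "cramer_transform M (l *\<^sub>R \<zeta>) \<le> ereal (l * t)"
      using l False by (intro cramer_transform_scale[OF M] cramer_transform_le_on_Zp_body[OF M _ \<zeta>(1)]) auto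
    also have "l *\<^sub>R \<zeta> = 2 *\<^sub>R (z /\<^sub>R C)" by (simp add: \<zeta>(2) l_def divide_inverse mult.commute)
    also have "ereal (l * t) \<le> ereal (2 * logcosh_cost t)"
    proof -
      have "l * t \<le> 1 / 108 * t" using l t by (intro mult_right_mono) auto
      also have "\<dots> \<le> 2 * (2 * t / 27)" using t by simp
      also have "\<dots> \<le> 2 * logcosh_cost t" using logcosh_cost_ge_linear[of t] False by simp
      finally show ?thesis by simp
    qed
    finally show ?thesis .
  qed
  have "property_tau M (\<lambda>x. cramer_transform M (x /\<^sub>R C))"
  proof (rule property_tau_of_enlargements[where K = K])
    fix t :: real assume t: "0 < t"
    show "compact (K t)"
      using compact_Zp_body[OF reg M(2)] by (auto simp: K_def intro!: compact_scaling)
    show "enlarges M (K t) t"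
      using cheeger_enlarges[OF cheeger \<open>0 < \<gamma>\<close> t] CI_enlarges[OF CI] by (auto simp: K_def)
  next
    fix t :: real and z assume "0 < t" "z \<in> K t"
    then show "- z \<in> K t"
      by (auto simp: K_def image_iff split: if_splits)
        (metis Zp_body_symmetric scaleR_minus_right)
  next
    show "(\<lambda>x. cramer_transform M (x /\<^sub>R C)) \<in> borel_measurable borel"
      using measurable_compose[OF _ cramer_transform_measurable] by measurable
    show "0 \<le> cramer_transform M (z /\<^sub>R C)" for z by (rule cramer_transform_nonneg)
    show "cramer_transform M (0 /\<^sub>R C) \<le> 0" using cramer_transform_0_le[OF M] by simp
  next
    fix t z assume tz: "0 < t" "z \<in> K t"
    have "cramer_transform M ((1 / 2) *\<^sub>R (2 *\<^sub>R (z /\<^sub>R C))) \<le> ereal (1 / 2 * (2 * logcosh_cost t))"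
      by (rule cramer_transform_scale[OF M _ _ double[OF tz]]) auto
    then show "cramer_transform M (z /\<^sub>R C) \<le> ereal (logcosh_cost t)" by simp
  next
    fix t t' z z' assume "0 < t" "0 < t'" "z \<in> K t" "z' \<in> K t'"
    then have "cramer_transform M (z /\<^sub>R C + z' /\<^sub>R C) \<le> ereal (logcosh_cost t + logcosh_cost t')"
      by (intro cramer_transform_midpoint double)
    then show "cramer_transform M ((z + z') /\<^sub>R C) \<le> ereal (logcosh_cost t + logcosh_cost t')"
      by (simp add: scaleR_right_distrib)
  qed
  then show "property_tau M (\<lambda>x. cramer_transform M (x /\<^sub>R (36 * max (6 * exp 1 * \<beta>) \<gamma>)))"
    by (simp add: C_def)
qed

end

theorem corollary3p10:
  fixes \<mu> :: "(real ^ 'n) measure" and \<alpha> \<beta> \<gamma> :: real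
  assumes "prob_space \<mu>" and "sets \<mu> = sets borel"
    and "\<alpha> \<ge> 1" and "regular_measure \<alpha> \<mu>" and "symmetric_measure \<mu>" and "isotropic \<mu>"
    and "\<beta> > 0" and "\<gamma> > 0"
  shows "(IC \<beta> \<mu> \<longrightarrow> CI (8 * exp 1 * \<alpha> * \<beta>) \<mu>) \<and>
         (CI \<beta> \<mu> \<and> cheeger (1 / \<gamma>) \<mu> \<longrightarrow> IC (36 * max (6 * exp 1 * \<beta>) \<gamma>) \<mu>)"
proof -
  interpret borel_prob_space \<mu>
    using assms by (intro borel_prob_space.intro borel_prob_space_axioms.intro)
  show ?thesis
    using IC_imp_CI CI_cheeger_imp_IC assms by blast
qed

end
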